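(* Let $\alpha>0$ and $\phi\in\omega_{\alpha,loc}$. The map $q_\phi$ defines a norm on $c_{0,0}$ and $$q_\phi(f*g)\le C_\phi\,q_\phi(f)\,q_\phi(g),\qquad f,g\in c_{0,0},$$ with $C_\phi>0$ independent of $f$ and $g$. Denote by $\tau^\alpha(\phi)$ the Banach algebra obtained as the completion of $c_{0,0}$ in the norm $q_\phi$. If moreover $\phi\in\omega_\alpha$, then: (i) the operator $\Delta$ is linear and bounded on $\tau^\alpha(\phi)$, i.e. $\Delta\in\mathcal{B}(\tau^\alpha(\phi))$; (ii) $\tau^\alpha(\phi)\hookrightarrow\tau^\alpha(k^{\alpha+1})\hookrightarrow\ell^1$, and $\lim_{\varepsilon\to0^+}q_\varepsilon(f)=\|f\|_1$ for $f\in c_{0,0}$; (iii) for $0<\alpha<\beta$, $\tau^\beta(k^{\beta+1})\hookrightarrow\tau^\alpha(k^{\alpha+1})$; (iv) for $0<\alpha<1$, $$q_\alpha(f*g)\le\left(2^{\alpha+1}\left(1+\frac{1-\alpha}{2(1+\alpha)}\right)^\alpha-1\right)q_\alpha(f)\,q_\alpha(g),\qquad f,g\in\tau^\alpha(k^{\alpha+1}).$$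
   Context: $\mathbb{N}_0=\{0,1,2,\dots\}$. $c_{0,0}$ is the space of complex sequences on $\mathbb{N}_0$ with finite support; $(f*g)(n)=\sum_{j=0}^nf(n-j)g(j)$; $\Delta f(n)=f(n+1)-f(n)$; $\hookrightarrow$ means continuous inclusion; $\|\cdot\|_1$ is the $\ell^1$ norm. For $\alpha>0$, $k^\alpha(n)=\frac{\Gamma(n+\alpha)}{\Gamma(\alpha)\Gamma(n+1)}$. Weyl sums and differences: for $f\in c_{0,0}$ and $\alpha>0$, $W^{-\alpha}f(n)=\sum_{j=n}^\infty k^\alpha(j-n)f(j)$ and $W^\alpha f=(-1)^m\Delta^mW^{-(m-\alpha)}f$ with $m=[\alpha]+1$. A positive sequence $\phi$ belongs to $\omega_{\alpha,loc}$ if there is $c_\phi>0$ with $$\Big(\sum_{n=0}^j+\sum_{n=p+1}^{j+p}\Big)k^\alpha(n)\phi(j+p-n)\le c_\phi\,\phi(j)\phi(p),\qquad 1\le j\le p.$$ $\omega_\alpha$ is the set of nondecreasing $\phi\in\omega_{\alpha,loc}$ which are of exponential type (i.e. $\phi(n)\le Ca^n$ for some $C,a>0$) and satisfy $\inf_{n\ge0}(k^{\alpha+1}(n))^{-1}\phi(n)>0$. For $\phi\in\omega_{\alpha,loc}$, $q_\phi(f)=\sum_{n=0}^\infty\phi(n)|W^\alpha f(n)|$ for $f\in c_{0,0}$; for $\phi=k^{\alpha+1}$ one writes $q_\alpha$ instead of $q_{k^{\alpha+1}}$, i.e. $q_\alpha(f)=\sum_{n=0}^\infty k^{\alpha+1}(n)|W^\alpha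 f(n)|$. "Banach algebra" is understood with submultiplicativity up to a multiplicative constant. *)

theory Defs
  imports
    "HOL-Analysis.Analysis"
    "HOL-Algebra.Module"
    "HOL-Algebra.Algebraic_Closure_Type"
begin

section \<open>Normed modules over the complex numbers\<close>

record 'a normed_module = "(complex, 'a) module" +
  nrm :: "'a \<Rightarrow> real"

definition normed_space :: "'a normed_module \<Rightarrow> bool" where
  "normed_space A \<longleftrightarrow>
     module ring_of_type_algebra A \<and>
     (\<forall>x\<in>carrier A. 0 \<le> nrm A x \<and> (nrm A x = 0 \<longleftrightarrow> x = \<zero>\<^bsub>A\<^esub>)) \<and>
     (\<forall>c. \<forall>x\<in>carrier A. nrm A (c \<odot>\<^bsub>A\<^esub> x) = cmod c * nrm A x) \<and>
     (\<forall>x\<in>carrier A. \<forall>y\<in>carrier A. nrm A (x \<oplus>\<^bsub>A\<^esub> y) \<le> nrm A x + nrm A y)"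

text \<open>The value outside the carrier only serves the locale \<^locale>\<open>Metric_space\<close>, which requires
  distances to be nonnegative and symmetric on the whole type.\<close>

definition nrm_dist :: "'a normed_module \<Rightarrow> 'a \<Rightarrow> 'a \<Rightarrow> real" where
  "nrm_dist A x y =
     (if x \<in> carrier A \<and> y \<in> carrier A then nrm A (x \<ominus>\<^bsub>A\<^esub> y) else 0)"

text \<open>Submultiplicativity is required only up to a multiplicative constant.
  The library locale \<^locale>\<open>algebra\<close> includes commutativity and a unit; all
  algebras considered here have both, the unit being the sequence (1, 0, 0, ...).\<close>

definition banach_algebra :: "'a normed_module \<Rightarrow> bool" where
  "banach_algebra A \<longleftrightarrow>
     algebra ring_of_type_algebra A \<and> normed_space A \<and>
     Metric_space.mcomplete (carrier A) (nrm_dist A) \<and>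
     (\<exists>C>0. \<forall>x\<in>carrier A. \<forall>y\<in>carrier A. nrm A (x \<otimes>\<^bsub>A\<^esub> y) \<le> C * nrm A x * nrm A y)"

definition bounded_linear_map ::
    "'a normed_module \<Rightarrow> 'b normed_module \<Rightarrow> ('a \<Rightarrow> 'b) \<Rightarrow> bool" where
  "bounded_linear_map A B T \<longleftrightarrow>
     T \<in> carrier A \<rightarrow> carrier B \<and>
     (\<forall>x\<in>carrier A. \<forall>y\<in>carrier A. T (x \<oplus>\<^bsub>A\<^esub> y) = T x \<oplus>\<^bsub>B\<^esub> T y) \<and>
     (\<forall>c. \<forall>x\<in>carrier A. T (c \<odot>\<^bsub>A\<^esub> x) = c \<odot>\<^bsub>B\<^esub> T x) \<and>
     (\<exists>C. \<forall>x\<in>carrier A. nrm B (T x) \<le> C * nrm A x)"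

section \<open>Completion\<close>

definition cauchy_seqs :: "'a normed_module \<Rightarrow> (nat \<Rightarrow> 'a) set" where
  "cauchy_seqs A = {F. Metric_space.MCauchy (carrier A) (nrm_dist A) F}"

definition null_diff :: "'a normed_module \<Rightarrow> ((nat \<Rightarrow> 'a) \<times> (nat \<Rightarrow> 'a)) set" where
  "null_diff A = {(F, G). F \<in> cauchy_seqs A \<and> G \<in> cauchy_seqs A \<and>
     (\<lambda>i. nrm_dist A (F i) (G i)) \<longlonglongrightarrow> 0}"

text \<open>Classes of Cauchy sequences modulo null sequences, with the termwise operations.
  The unions over representatives are the usual device for lifting an operation to a
  quotient; they are single classes whenever the operation respects the equivalence.\<close>

definition completion :: "'a normed_module \<Rightarrow> (nat \<Rightarrow> 'a) set normed_module" where
  "completion A =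
    \<lparr> carrier = cauchy_seqs A // null_diff A,
      mult = (\<lambda>P Q. \<Union>F\<in>P. \<Union>G\<in>Q. null_diff A `` {\<lambda>i. F i \<otimes>\<^bsub>A\<^esub> G i}),
      one = null_diff A `` {\<lambda>i. \<one>\<^bsub>A\<^esub>},
      zero = null_diff A `` {\<lambda>i. \<zero>\<^bsub>A\<^esub>},
      add = (\<lambda>P Q. \<Union>F\<in>P. \<Union>G\<in>Q. null_diff A `` {\<lambda>i. F i \<oplus>\<^bsub>A\<^esub> G i}),
      smult = (\<lambda>c P. \<Union>F\<in>P. null_diff A `` {\<lambda>i. c \<odot>\<^bsub>A\<^esub> F i}),
      nrm = (\<lambda>P. THE r. \<forall>F\<in>P. (\<lambda>i. nrm A (F i)) \<longlonglongrightarrow> r) \<rparr>"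

definition completion_embed :: "'a normed_module \<Rightarrow> 'a \<Rightarrow> (nat \<Rightarrow> 'a) set" where
  "completion_embed A x = null_diff A `` {\<lambda>i. x}"

section \<open>Sequences, convolution and the difference operator\<close>

definition c00 :: "(nat \<Rightarrow> complex) set" where
  "c00 = {f. finite {n. f n \<noteq> 0}}"

definition conv :: "(nat \<Rightarrow> complex) \<Rightarrow> (nat \<Rightarrow> complex) \<Rightarrow> nat \<Rightarrow> complex" where
  "conv f g n = (\<Sum>j\<le>n. f (n - j) * g j)"

definition Delta :: "(nat \<Rightarrow> complex) \<Rightarrow> nat \<Rightarrow> complex" where
  "Delta f n = f (n + 1) - f n"

definition seq_algebra ::
    "(nat \<Rightarrow> complex) set \<Rightarrow> ((nat \<Rightarrow> complex) \<Rightarrow> real) \<Rightarrow> (nat \<Rightarrow> complex) normed_module" where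
  "seq_algebra S N =
    \<lparr> carrier = S,
      mult = conv,
      one = (\<lambda>n. if n = 0 then 1 else 0),
      zero = (\<lambda>n. 0),
      add = (\<lambda>f g n. f n + g n),
      smult = (\<lambda>c f n. c * f n),
      nrm = N \<rparr>"

definition l1_norm :: "(nat \<Rightarrow> complex) \<Rightarrow> real" where
  "l1_norm f = (\<Sum>n. cmod (f n))"

definition l1 :: "(nat \<Rightarrow> complex) normed_module" where
  "l1 = seq_algebra {f. summable (\<lambda>n. cmod (f n))} l1_norm"

section \<open>Weyl sums and differences\<close>

definition cesaro :: "real \<Rightarrow> nat \<Rightarrow> real" where
  "cesaro \<alpha> n = Gamma (real n + \<alpha>) / (Gamma \<alpha> * Gamma (real n + 1))"

text \<open>\<open>weyl_sum \<alpha>\<close> is \<open>W\<close> with exponent \<open>-\<alpha>\<close>, and \<open>weyl_diff \<alpha>\<close> is \<open>W\<close> with exponent \<open>\<alpha>\<close>;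
  both are meant for \<open>\<alpha> > 0\<close> and finitely supported sequences.\<close>

definition weyl_sum :: "real \<Rightarrow> (nat \<Rightarrow> complex) \<Rightarrow> nat \<Rightarrow> complex" where
  "weyl_sum \<alpha> f n = (\<Sum>\<^sub>\<infinity>j\<in>{n..}. of_real (cesaro \<alpha> (j - n)) * f j)"

definition weyl_diff :: "real \<Rightarrow> (nat \<Rightarrow> complex) \<Rightarrow> nat \<Rightarrow> complex" where
  "weyl_diff \<alpha> f n =
     (let m = nat \<lfloor>\<alpha>\<rfloor> + 1 in (-1) ^ m * (Delta ^^ m) (weyl_sum (real m - \<alpha>) f) n)"

definition omega_loc :: "real \<Rightarrow> (nat \<Rightarrow> real) set" where
  "omega_loc \<alpha> = {\<phi>. (\<forall>n. 0 < \<phi> n) \<and>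
     (\<exists>c>0. \<forall>j p. 1 \<le> j \<and> j \<le> p \<longrightarrow>
        (\<Sum>n=0..j. cesaro \<alpha> n * \<phi> (j + p - n)) + (\<Sum>n=p+1..j+p. cesaro \<alpha> n * \<phi> (j + p - n))
          \<le> c * \<phi> j * \<phi> p)}"

definition omega :: "real \<Rightarrow> (nat \<Rightarrow> real) set" where
  "omega \<alpha> = {\<phi> \<in> omega_loc \<alpha>. mono \<phi> \<and>
     (\<exists>C>0. \<exists>a>0. \<forall>n. \<phi> n \<le> C * a ^ n) \<and>
     (INF n. inverse (cesaro (\<alpha> + 1) n) * \<phi> n) > 0}"

definition weyl_norm :: "real \<Rightarrow> (nat \<Rightarrow> real) \<Rightarrow> (nat \<Rightarrow> complex) \<Rightarrow> real" where
  "weyl_norm \<alpha> \<phi> f = (\<Sum>n. \<phi> n * cmod (weyl_diff \<alpha> f n))"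

definition tau :: "real \<Rightarrow> (nat \<Rightarrow> real) \<Rightarrow> (nat \<Rightarrow> nat \<Rightarrow> complex) set normed_module" where
  "tau \<alpha> \<phi> = completion (seq_algebra c00 (weyl_norm \<alpha> \<phi>))"

definition tau_embed ::
    "real \<Rightarrow> (nat \<Rightarrow> real) \<Rightarrow> (nat \<Rightarrow> complex) \<Rightarrow> (nat \<Rightarrow> nat \<Rightarrow> complex) set" where
  "tau_embed \<alpha> \<phi> = completion_embed (seq_algebra c00 (weyl_norm \<alpha> \<phi>))"

text \<open>Let \<open>iA\<close> and \<open>iB\<close> be the canonical maps of \<^const>\<open>c00\<close> into \<open>A\<close> and \<open>B\<close>. When the image of
  \<open>iA\<close> is dense, there is at most one bounded linear \<open>J\<close> which is the identity on \<^const>\<open>c00\<close>.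
  Injectivity of \<open>J\<close> is what makes \<open>A\<close> a subspace of \<open>B\<close>.\<close>

definition continuous_inclusion ::
    "'a normed_module \<Rightarrow> ((nat \<Rightarrow> complex) \<Rightarrow> 'a) \<Rightarrow>
     'b normed_module \<Rightarrow> ((nat \<Rightarrow> complex) \<Rightarrow> 'b) \<Rightarrow> bool" where
  "continuous_inclusion A iA B iB \<longleftrightarrow>
     (\<exists>J. bounded_linear_map A B J \<and> inj_on J (carrier A) \<and> (\<forall>f\<in>c00. J (iA f) = iB f))"

end

theory Submission
  imports Defs
begin

text \<open>
  Since \<open>1 - S\<close>, with \<open>S\<close> the backward shift, is minus the difference operator, the Weyl operators
  on finitely supported sequences are the binomial series \<open>(1 - S) powr a\<close>; they compose by adding
  exponents. With \<open>h\<^sub>p\<close> the Weyl sum of the unit sequence at \<open>p\<close>, the norm \<open>q\<^sub>\<phi>\<close> is the weighted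
  \<open>\<ell>\<^sup>1\<close> norm of the coordinates in the basis \<open>h\<^sub>p\<close>, and \<open>h\<^sub>j * h\<^sub>p\<close> is
  the sum of \<open>k\<^sup>\<alpha>(n) h\<^sub>j\<^sub>+\<^sub>p\<^sub>-\<^sub>n\<close> over \<open>n \<le> j\<close> minus the same sum over \<open>p < n \<le> j + p\<close>. Its norm is thus
  bounded by the left-hand side of the condition defining \<open>\<omega>\<^sub>\<alpha>\<^sub>,\<^sub>l\<^sub>o\<^sub>c\<close>. Comparisons of norms need only be checked
  on the \<open>h\<^sub>p\<close>. The coordinates are \<open>\<ell>\<^sup>1\<close>-continuous, so by Fatou's lemma
  a \<open>q\<^sub>\<phi>\<close>-Cauchy sequence which tends to 0 in \<open>\<ell>\<^sup>1\<close> tends to 0 in \<open>q\<^sub>\<phi>\<close>; this makes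
  the inclusions of the completions injective. For \<open>0 < \<alpha> < 1\<close> the monotonicity of \<open>k\<^sup>\<alpha>\<close> yields the
  constant \<open>1 + \<alpha> + \<alpha> / (1 + \<alpha>)\<close> for \<open>q\<^sub>\<alpha>\<close>, which is smaller than the one claimed.
\<close>

section \<open>Weyl operators and their norms\<close>

text \<open>The coefficient of x^n in (1 - x)^(-a). For a > 0 it equals \<open>cesaro a n\<close>,
  but the Pochhammer form makes sense for every real a, including the nonpositive integers, where
  the Gamma quotient degenerates. Weyl sums (a > 0) and Weyl differences (a < 0) are thus handled by
  the same coefficients.\<close>

definition wcoef :: "real \<Rightarrow> nat \<Rightarrow> real" where
  "wcoef a n = pochhammer a n / fact n"

lemma cesaro_eq_wcoef:
  assumes "a > 0"
  shows "cesaro a n = wcoef a n"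
proof -
  have "a \<notin> \<int>\<^sub>\<le>\<^sub>0" using assms by (auto elim!: nonpos_Ints_cases)
  then show ?thesis
    by (simp add: cesaro_def wcoef_def pochhammer_Gamma Gamma_fact[symmetric] add.commute)
qed

lemma wcoef_0 [simp]: "wcoef a 0 = 1"
  by (simp add: wcoef_def)

lemma wcoef_zero: "wcoef 0 n = (if n = 0 then 1 else 0)"
  by (simp add: wcoef_def pochhammer_0_left)

lemma wcoef_Suc: "wcoef a (Suc n) = wcoef a n * ((a + n) / (n + 1))"
  by (simp add: wcoef_def pochhammer_Suc field_simps)

lemma wcoef_1: "wcoef 1 n = 1"
  by (induction n) (auto simp: wcoef_Suc)

lemma wcoef_pos: "a > 0 \<Longrightarrow> 0 < wcoef a n"
  by (simp add: wcoef_def pochhammer_pos)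

lemma wcoef_nonneg: "a \<ge> 0 \<Longrightarrow> 0 \<le> wcoef a n"
  using wcoef_pos[of a n] by (cases "a = 0") (auto simp: wcoef_zero)

lemma wcoef_minus1: "wcoef (-1) n = (if n = 0 then 1 else if n = 1 then -1 else 0)"
proof (cases n)
  case (Suc m)
  show ?thesis unfolding Suc by (induction m) (auto simp: wcoef_Suc)
qed simp

text \<open>The Chu-Vandermonde identity: coefficients of x^n in (1 - x)^(-a) (1 - x)^(-b) = (1 -
  x)^(-(a + b)).\<close>

lemma wcoef_convolution: "(\<Sum>k\<le>n. wcoef a k * wcoef b (n - k)) = wcoef (a + b) n"
proof -
  have "wcoef a k * wcoef b (n - k)
      = of_nat (n choose k) * pochhammer a k * pochhammer b (n - k) / fact n" if "k \<le> n" for k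
    using that by (simp add: wcoef_def binomial_fact field_simps)
  then show ?thesis
    by (simp add: wcoef_def pochhammer_binomial_sum sum_divide_distrib)
qed

text \<open>The ratio of consecutive coefficients is (a + n) / (n + 1), which lies between 0 and 1
  as soon as n \<ge> -a. The absolute values therefore do not grow from \<open>N\<close> on, and
  \<open>B\<close> only has to dominate the terms up to \<open>N\<close>.\<close>

lemma wcoef_bounded:
  assumes "a \<le> 1"
  shows "\<exists>B>0. \<forall>n. \<bar>wcoef a n\<bar> \<le> B"
proof -
  obtain N :: nat where N: "- a \<le> real N" using real_arch_simple by blast
  define B where "B = 1 + (\<Sum>n\<le>N. \<bar>wcoef a n\<bar>)"
  have small: "\<bar>wcoef a n\<bar> \<le> B" if "n \<le> N" for n
    using member_le_sum[of n "{..N}" "\<lambda>n. \<bar>wcoef a n\<bar>"] that by (simp add: B_def)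
  have "\<bar>wcoef a (N + m)\<bar> \<le> B" for m
  proof (induction m)
    case (Suc m)
    have "\<bar>(a + real (N + m)) / (real (N + m) + 1)\<bar> \<le> 1" using assms N by (simp add: divide_simps)
    then have "\<bar>wcoef a (Suc (N + m))\<bar> \<le> \<bar>wcoef a (N + m)\<bar> * 1"
      unfolding wcoef_Suc abs_mult by (intro mult_left_mono) auto
    with Suc show ?case by simp
  qed (simp add: small)
  then have "\<bar>wcoef a n\<bar> \<le> B" for n
    using small[of n] by (metis le_add_diff_inverse nat_le_linear)
  moreover have "B > 0" unfolding B_def by (smt (verit) sum_nonneg abs_ge_zero)
  ultimately show ?thesis by blast
qed

section \<open>Finitely supported sequences\<close>

lemma c00_iff: "f \<in> c00 \<longleftrightarrow> (\<exists>N. \<forall>n\<ge>N. f n = 0)"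
proof
  assume "f \<in> c00"
  then obtain N where "{n. f n \<noteq> 0} \<subseteq> {..<N}"
    unfolding c00_def using finite_nat_iff_bounded by blast
  then show "\<exists>N. \<forall>n\<ge>N. f n = 0" by (intro exI[of _ N]) force
next
  assume "\<exists>N. \<forall>n\<ge>N. f n = 0"
  then obtain N where "\<forall>n\<ge>N. f n = 0" ..
  then have "{n. f n \<noteq> 0} \<subseteq> {..<N}" by (auto simp: not_le[symmetric])
  then show "f \<in> c00" unfolding c00_def using finite_subset by blast
qed

lemma c00_common_bound:
  assumes "f \<in> c00" "g \<in> c00"
  obtains N where "\<And>n. n \<ge> N \<Longrightarrow> f n = 0" "\<And>n. n \<ge> N \<Longrightarrow> g n = 0"
proof -
  obtain N M where "\<forall>n\<ge>N. f n = 0" "\<forall>n\<ge>M. g n = 0" using assms c00_iff by blast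
  then show thesis using that[of "max N M"] by simp
qed

lemma zero_c00 [simp]: "(\<lambda>n. 0) \<in> c00" and one_c00: "(\<lambda>n. if n = 0 then 1 else 0) \<in> c00"
  and delta_c00: "(\<lambda>n. if n = p then 1 else 0) \<in> c00"
  by (simp_all add: c00_def)

lemma add_c00: "f \<in> c00 \<Longrightarrow> g \<in> c00 \<Longrightarrow> (\<lambda>n. f n + g n) \<in> c00"
  and diff_c00: "f \<in> c00 \<Longrightarrow> g \<in> c00 \<Longrightarrow> (\<lambda>n. f n - g n) \<in> c00"
  and smult_c00: "f \<in> c00 \<Longrightarrow> (\<lambda>n. c * f n) \<in> c00"
  unfolding c00_iff
    by (metis add.right_neutral nat_le_linear order_trans)
      (metis diff_zero nat_le_linear order_trans, metis mult_zero_right)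

lemma sum_c00: "(\<And>i. i \<in> I \<Longrightarrow> x i \<in> c00) \<Longrightarrow> (\<lambda>n. \<Sum>i\<in>I. c i * x i n) \<in> c00"
  by (induction I rule: infinite_finite_induct) (simp_all add: add_c00 smult_c00)

section \<open>Weyl operators as triangular Toeplitz matrices\<close>

definition weyl_op :: "(nat \<Rightarrow> real) \<Rightarrow> (nat \<Rightarrow> complex) \<Rightarrow> nat \<Rightarrow> complex" where
  "weyl_op a f n = (\<Sum>\<^sub>\<infinity>j\<in>{n..}. of_real (a (j - n)) * f j)"

text \<open>Keeping the condition \<open>n \<le> j\<close> inside the summand gives all rows n the
  same index range \<open>{..<N}\<close>, so that double sums can be interchanged.\<close>

lemma weyl_op_eq_sum:
  assumes "\<And>n. n \<ge> N \<Longrightarrow> f n = 0"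
  shows "weyl_op a f n = (\<Sum>j<N. (if n \<le> j then of_real (a (j - n)) else 0) * f j)"
proof -
  have "weyl_op a f n = (\<Sum>\<^sub>\<infinity>j\<in>{..<N}. (if n \<le> j then of_real (a (j - n)) else 0) * f j)"
    unfolding weyl_op_def by (intro infsum_cong_neutral) (auto simp: assms)
  then show ?thesis by simp
qed

text \<open>Row n only involves entries with index at least n. Hence one bound \<open>N\<close>
  serves a sequence and all its images under such operators.\<close>

lemma weyl_op_vanishes:
  assumes "\<And>n. n \<ge> N \<Longrightarrow> f n = 0" "n \<ge> N"
  shows "weyl_op a f n = 0"
  by (subst weyl_op_eq_sum[of N]) (use assms in \<open>auto intro!: sum.neutral\<close>)

lemma weyl_op_c00: "f \<in> c00 \<Longrightarrow> weyl_op a f \<in> c00"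
  unfolding c00_iff using weyl_op_vanishes by metis

lemma weyl_op_add:
  assumes "f \<in> c00" "g \<in> c00"
  shows "weyl_op a (\<lambda>n. f n + g n) = (\<lambda>n. weyl_op a f n + weyl_op a g n)"
proof -
  obtain N where "\<And>n. n \<ge> N \<Longrightarrow> f n = 0" "\<And>n. n \<ge> N \<Longrightarrow> g n = 0"
    using c00_common_bound assms by blast
  then show ?thesis
    by (intro ext) (simp add: weyl_op_eq_sum[of N] distrib_left sum.distrib)
qed

lemma weyl_op_smult: "weyl_op a (\<lambda>n. c * f n) = (\<lambda>n. c * weyl_op a f n)"
  unfolding weyl_op_def infsum_cmult_right'[symmetric]
  by (intro ext infsum_cong) (simp add: algebra_simps)

text \<open>The product of two upper triangular Toeplitz matrices is again of this form, and the
  entries on its diagonals are the Cauchy product of the two coefficient sequences.\<close>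

lemma weyl_op_comp:
  assumes "f \<in> c00" and c: "\<And>n. c n = (\<Sum>k\<le>n. a k * b (n - k))"
  shows "weyl_op a (weyl_op b f) = weyl_op c f"
proof
  fix n
  obtain N where N: "\<And>n. n \<ge> N \<Longrightarrow> f n = 0" using assms c00_iff by blast
  let ?m = "\<lambda>a n j :: nat. if n \<le> j then complex_of_real (a (j - n)) else 0"
  have *: "(\<Sum>j<N. ?m a n j * ?m b j l) = ?m c n l" if "l < N" for l
  proof (cases "n \<le> l")
    case True
    \<comment> \<open>Both factors can be nonzero only for n \<le> j \<le> l, a range that lies
      below \<open>N\<close> because l < N.\<close>
    have "(\<Sum>j<N. ?m a n j * ?m b j l) = (\<Sum>j\<in>{n..l}. of_real (a (j - n) * b (l - j)))"
      using that by (intro sum.mono_neutral_cong_right) auto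
    also have "\<dots> = (\<Sum>k\<le>l - n. of_real (a k * b (l - n - k)))"
      by (rule sum.reindex_bij_witness[of _ "\<lambda>k. k + n" "\<lambda>j. j - n"]) (use True in auto)
    finally show ?thesis using True by (simp add: c)
  qed (auto intro!: sum.neutral)
  have "weyl_op a (weyl_op b f) n = (\<Sum>j<N. ?m a n j * (\<Sum>l<N. ?m b j l * f l))"
    by (simp only: weyl_op_eq_sum[of N "weyl_op b f", OF weyl_op_vanishes[OF N]] weyl_op_eq_sum[of N f, OF N])
  also have "\<dots> = (\<Sum>l<N. (\<Sum>j<N. ?m a n j * ?m b j l) * f l)"
    unfolding sum_distrib_left sum_distrib_right by (subst sum.swap) (simp only: mult.assoc)
  also have "\<dots> = (\<Sum>l<N. ?m c n l * f l)" by (intro sum.cong) (simp_all only: * lessThan_iff)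
  also have "\<dots> = weyl_op c f n" by (simp only: weyl_op_eq_sum[of N f, OF N])
  finally show "weyl_op a (weyl_op b f) n = weyl_op c f n" .
qed

lemma weyl_op_wcoef_comp:
  "f \<in> c00 \<Longrightarrow> weyl_op (wcoef a) (weyl_op (wcoef b) f) = weyl_op (wcoef (a + b)) f"
  by (rule weyl_op_comp) (simp_all add: wcoef_convolution)

lemma weyl_op_wcoef_zero: 
  assumes "f \<in> c00" shows "weyl_op (wcoef 0) f = f"
proof
  fix n
  obtain N where N: "\<And>n. n \<ge> N \<Longrightarrow> f n = 0" using assms c00_iff by blast
  then have N': "\<And>m. m \<ge> max N (Suc n) \<Longrightarrow> f m = 0" by simp
  have "weyl_op (wcoef 0) f n = (\<Sum>j<max N (Suc n). if j = n then f n else 0)"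
    by (subst weyl_op_eq_sum[OF N'], assumption, intro sum.cong) (auto simp: wcoef_zero)
  then show "weyl_op (wcoef 0) f n = f n" by (simp add: sum.delta)
qed

text \<open>The sequence \<open>wcoef (-1)\<close> is 1, -1, 0, 0, ..., the coefficients of 1 - x,
  where x stands for the backward shift.\<close>

lemma Delta_eq_weyl_op:
  assumes "f \<in> c00" shows "Delta f = (\<lambda>n. - weyl_op (wcoef (-1)) f n)"
proof
  fix n
  obtain N where N: "\<And>n. n \<ge> N \<Longrightarrow> f n = 0" using assms c00_iff by blast
  \<comment> \<open>The bound is raised past n + 1, so that both n and n + 1 lie in the range of
    summation.\<close>
  then have N': "\<And>m. m \<ge> N + n + 2 \<Longrightarrow> f m = 0" by simp
  have "weyl_op (wcoef (-1)) f n
      = (\<Sum>j<N + n + 2. (if j = n then f n else 0) - (if j = Suc n then f (Suc n) else 0))"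
    by (subst weyl_op_eq_sum[OF N'], assumption, intro sum.cong) (auto simp: wcoef_minus1)
  also have "\<dots> = f n - f (Suc n)" by (simp add: sum_subtractf sum.delta)
  finally show "Delta f n = - weyl_op (wcoef (-1)) f n" by (simp add: Delta_def)
qed

lemma Delta_c00: "f \<in> c00 \<Longrightarrow> Delta f \<in> c00"
  using smult_c00[OF weyl_op_c00, of f "-1"] by (simp add: Delta_eq_weyl_op)

lemma Delta_funpow_eq_weyl_op:
  "f \<in> c00 \<Longrightarrow> (Delta ^^ m) f = (\<lambda>n. (-1) ^ m * weyl_op (wcoef (- real m)) f n)"
proof (induction m)
  case 0
  then show ?case by (simp add: weyl_op_wcoef_zero)
next
  case (Suc m)
  have "(Delta ^^ Suc m) f = Delta (\<lambda>n. (-1) ^ m * weyl_op (wcoef (- real m)) f n)"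
    using Suc by simp
  also have "\<dots> = (\<lambda>n. - ((-1) ^ m * weyl_op (wcoef (-1)) (weyl_op (wcoef (- real m)) f) n))"
    by (subst Delta_eq_weyl_op) (simp_all add: smult_c00 weyl_op_c00 Suc.prems weyl_op_smult)
  finally show ?case using Suc.prems by (simp add: weyl_op_wcoef_comp)
qed

text \<open>The exponent -m of the m-th difference and the exponent m - \<alpha> of the Weyl sum add
  up to -\<alpha>, and the two signs (-1)^m cancel. The case \<alpha> = 0 is included because it
  gives the l1 norm.\<close>

lemma weyl_diff_eq_weyl_op:
  assumes "\<alpha> \<ge> 0" "f \<in> c00"
  shows "weyl_diff \<alpha> f = weyl_op (wcoef (- \<alpha>)) f"
proof
  fix n
  define m where "m = nat \<lfloor>\<alpha>\<rfloor> + 1"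
  \<comment> \<open>The strict inequality allows \<open>cesaro\<close> to be replaced by
    \<open>wcoef\<close>; it holds since m is one more than the floor of \<alpha>, also when
    \<alpha> is an integer.\<close>
  have m: "real m - \<alpha> > 0" unfolding m_def using assms(1) by linarith
  have "weyl_sum (real m - \<alpha>) f = weyl_op (wcoef (real m - \<alpha>)) f"
    by (simp add: weyl_sum_def[abs_def] weyl_op_def[abs_def] cesaro_eq_wcoef[OF m])
  then have "weyl_diff \<alpha> f n = (-1) ^ m * (Delta ^^ m) (weyl_op (wcoef (real m - \<alpha>)) f) n"
    by (simp only: weyl_diff_def m_def Let_def)
  also have "\<dots> = weyl_op (wcoef (- \<alpha>)) f n"
    using assms(2)
    by (simp add: Delta_funpow_eq_weyl_op weyl_op_c00 weyl_op_wcoef_comp flip: mult.assoc power_mult_distrib)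
  finally show "weyl_diff \<alpha> f n = weyl_op (wcoef (- \<alpha>)) f n" .
qed

section \<open>Convolution\<close>

lemma conv_eq_fps_mult: "Abs_fps (conv f g) = Abs_fps f * Abs_fps g"
proof -
  \<comment> \<open>The factors come out in reverse order: \<open>conv\<close> puts the summation
    index on its second argument, the product of power series puts it on the first.\<close>
  have "Abs_fps (conv f g) = Abs_fps g * Abs_fps f"
    by (intro fps_ext, simp add: conv_def fps_mult_nth atLeast0AtMost) (simp add: mult.commute)
  then show ?thesis by (simp add: mult.commute)
qed

text \<open>Through this identity commutativity and associativity of convolution are inherited from
  the ring of formal power series.\<close>

lemma conv_nth: "conv f g n = (Abs_fps f * Abs_fps g) $ n"
  by (simp flip: conv_eq_fps_mult)

lemma conv_commute: "conv f g = conv g f"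
  by (intro ext) (simp add: conv_nth mult.commute)

lemma conv_assoc: "conv (conv f g) h = conv f (conv g h)"
  by (intro ext) (simp add: conv_nth conv_eq_fps_mult mult.assoc)

lemma conv_one: "conv (\<lambda>n. if n = 0 then 1 else 0) f = f"
  by (subst conv_commute) (auto simp: conv_def fun_eq_iff if_distrib cong: if_cong)

lemma conv_add: "conv (\<lambda>n. f n + g n) h = (\<lambda>n. conv f h n + conv g h n)"
  by (intro ext) (simp add: conv_def distrib_right sum.distrib)

lemma conv_smult: "conv (\<lambda>n. c * f n) g = (\<lambda>n. c * conv f g n)"
  by (intro ext) (simp add: conv_def sum_distrib_left mult.assoc)

lemma conv_sum_left: "conv (\<lambda>n. \<Sum>i\<in>I. c i * x i n) g = (\<lambda>n. \<Sum>i\<in>I. c i * conv (x i) g n)"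
  unfolding conv_def sum_distrib_left sum_distrib_right by (subst sum.swap) (simp only: mult.assoc)

text \<open>The double sum is written over pairs, so that the triangle inequality for a single
  finite sum applies to it.\<close>

lemma conv_sum_sum:
  "conv (\<lambda>n. \<Sum>i\<in>I. c i * x i n) (\<lambda>n. \<Sum>j\<in>J. d j * y j n)
    = (\<lambda>n. \<Sum>(i, j)\<in>I \<times> J. (c i * d j) * conv (x i) (y j) n)"
  by (simp add: conv_sum_left conv_commute[of _ "\<lambda>n. \<Sum>j\<in>J. d j * y j n"] 
      conv_commute[of "y _" "x _"] sum_distrib_left sum.cartesian_product mult.assoc)

lemma conv_c00:
  assumes "f \<in> c00" "g \<in> c00" shows "conv f g \<in> c00"
proof -
  obtain N where "\<And>n. n \<ge> N \<Longrightarrow> f n = 0" "\<And>n. n \<ge> N \<Longrightarrow> g n = 0"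
    using c00_common_bound assms by blast
  then have zero: "f (n - j) * g j = 0" if "n \<ge> N + N" for n j
    using that by (cases "j \<ge> N") auto
  then have "conv f g n = 0" if "n \<ge> N + N" for n
    unfolding conv_def using zero[OF that] by (intro sum.neutral) blast
  then show ?thesis unfolding c00_iff by blast
qed

text \<open>The basis \<open>h\<^sub>p\<close>.\<close>

definition atom :: "real \<Rightarrow> nat \<Rightarrow> nat \<Rightarrow> complex" where
  "atom \<alpha> p n = (if n \<le> p then of_real (wcoef \<alpha> (p - n)) else 0)"

lemma atom_c00: "atom \<alpha> p \<in> c00"
  unfolding c00_iff by (intro exI[of _ "Suc p"]) (simp add: atom_def)

lemma atom_eq_weyl_op: "atom \<alpha> p = weyl_op (wcoef \<alpha>) (\<lambda>n. if n = p then 1 else 0)"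
proof
  fix n
  have "weyl_op (wcoef \<alpha>) (\<lambda>n. if n = p then 1 else 0) n
      = (\<Sum>j<Suc p. if j = p then atom \<alpha> p n else 0)"
    by (subst weyl_op_eq_sum[of "Suc p"]) (auto simp: atom_def intro!: sum.cong)
  then show "atom \<alpha> p n = weyl_op (wcoef \<alpha>) (\<lambda>n. if n = p then 1 else 0) n"
    by (simp add: sum.delta)
qed

lemma weyl_op_atom: "weyl_op (wcoef \<beta>) (atom \<alpha> p) = atom (\<beta> + \<alpha>) p"
  by (simp add: atom_eq_weyl_op weyl_op_wcoef_comp delta_c00)

text \<open>Reads f = \<open>weyl_op (wcoef \<alpha>) (weyl_op (wcoef (- \<alpha>)) f)\<close> as a
  matrix applied to a vector: the columns of the outer operator are the atoms, and the coordinates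
  of f are the values of its Weyl difference.\<close>

lemma atom_expansion:
  assumes "\<And>n. n \<ge> N \<Longrightarrow> f n = 0"
  shows "f = (\<lambda>n. \<Sum>p<N. weyl_op (wcoef (- \<alpha>)) f p * atom \<alpha> p n)"
proof
  fix n
  have f: "f \<in> c00" using assms c00_iff by blast
  have "f n = weyl_op (wcoef \<alpha>) (weyl_op (wcoef (- \<alpha>)) f) n"
    by (simp add: weyl_op_wcoef_comp weyl_op_wcoef_zero f)
  also have "\<dots> = (\<Sum>p<N. atom \<alpha> p n * weyl_op (wcoef (- \<alpha>)) f p)"
    unfolding atom_def by (rule weyl_op_eq_sum) (rule weyl_op_vanishes[OF assms])
  finally show "f n = (\<Sum>p<N. weyl_op (wcoef (- \<alpha>)) f p * atom \<alpha> p n)" by (simp add: mult.commute)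
qed

text \<open>With N = j + p - m, the value at m is the sum of k(u) k(N - u) over the u with u \<le> j
  and N - u \<le> p, where k is \<open>wcoef \<alpha>\<close>. Dropping the second constraint gives
  the first sum; the surplus is the second sum. Above j + p everything vanishes.\<close>

lemma conv_atom:
  "conv (atom \<alpha> j) (atom \<alpha> p) = (\<lambda>m. (\<Sum>l\<le>j. of_real (wcoef \<alpha> l) * atom \<alpha> (j + p - l) m)
     - (\<Sum>l=p+1..j+p. of_real (wcoef \<alpha> l) * atom \<alpha> (j + p - l) m))"
proof
  fix m
  let ?R1 = "\<Sum>l\<le>j. of_real (wcoef \<alpha> l) * atom \<alpha> (j + p - l) m"
  let ?R2 = "\<Sum>l=p+1..j+p. of_real (wcoef \<alpha> l) * atom \<alpha> (j + p - l) m"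
  show "conv (atom \<alpha> j) (atom \<alpha> p) m = ?R1 - ?R2"
  proof (cases "m \<le> j + p")
    case False
    have "conv (atom \<alpha> j) (atom \<alpha> p) m = 0"
      unfolding conv_def by (rule sum.neutral) (use False in \<open>auto simp: atom_def\<close>)
    moreover have "?R1 = 0" "?R2 = 0" using False by (auto simp: atom_def intro!: sum.neutral)
    ultimately show ?thesis by simp
  next
    case True
    define N where "N = j + p - m"
    define t where "t u = complex_of_real (wcoef \<alpha> u * wcoef \<alpha> (N - u))" for u
    have "conv (atom \<alpha> j) (atom \<alpha> p) m = (\<Sum>b\<in>{b. b \<le> m \<and> m - b \<le> j \<and> b \<le> p}. 
        of_real (wcoef \<alpha> (j - (m - b)) * wcoef \<alpha> (p - b)))"
      unfolding conv_def by (rule sum.mono_neutral_cong_right) (auto simp: atom_def)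
    \<comment> \<open>The substitution u = b + j - m makes the factors k(u) and k(N - u); b \<le> m
      becomes u \<le> j, and b \<ge> 0 becomes N - u \<le> p.\<close>
    also have "\<dots> = (\<Sum>u\<in>{u. u \<le> N \<and> u \<le> j} - {u. u \<le> N \<and> N - u > p}. t u)"
      by (rule sum.reindex_bij_witness[of _ "\<lambda>u. u + m - j" "\<lambda>b. b + j - m"])
        (use True in \<open>auto simp: N_def t_def add.commute\<close>)
    \<comment> \<open>The removed set is contained in the other one: N - u > p forces u < j - m,
      hence u \<le> j.\<close>
    also have "\<dots> = (\<Sum>u\<in>{u. u \<le> N \<and> u \<le> j}. t u) - (\<Sum>u\<in>{u. u \<le> N \<and> N - u > p}. t u)"
      by (rule sum_diff) (use True in \<open>auto simp: N_def\<close>)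
    also have "(\<Sum>u\<in>{u. u \<le> N \<and> u \<le> j}. t u) = ?R1"
      by (rule sum.mono_neutral_cong_left) (use True in \<open>auto simp: N_def t_def atom_def add.commute\<close>)
    \<comment> \<open>The reflection of u to N - u leaves \<open>t\<close> invariant and turns N - u
      > p into u > p.\<close>
    also have "(\<Sum>u\<in>{u. u \<le> N \<and> N - u > p}. t u) = (\<Sum>u\<in>{u. u \<le> N \<and> u > p}. t u)"
      by (rule sum.reindex_bij_witness[of _ "\<lambda>u. N - u" "\<lambda>u. N - u"]) (auto simp: t_def)
    also have "\<dots> = ?R2"
      by (rule sum.mono_neutral_cong_left) (use True in \<open>auto simp: N_def t_def atom_def add.commute\<close>)
    finally show ?thesis .
  qed
qed

section \<open>The weighted norms on finitely supported sequences\<close>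

lemma weyl_norm_eq_sum:
  assumes "\<alpha> \<ge> 0" "\<And>n. n \<ge> N \<Longrightarrow> f n = 0"
  shows "weyl_norm \<alpha> \<phi> f = (\<Sum>n<N. \<phi> n * cmod (weyl_op (wcoef (- \<alpha>)) f n))"
proof -
  have "f \<in> c00" using assms(2) c00_iff by blast
  then show ?thesis
    unfolding weyl_norm_def weyl_diff_eq_weyl_op[OF assms(1) \<open>f \<in> c00\<close>]
    by (intro suminf_finite) (auto simp: weyl_op_vanishes[OF assms(2)])
qed

lemma weyl_norm_add:
  assumes "\<alpha> \<ge> 0" "\<And>n. \<phi> n \<ge> 0" "f \<in> c00" "g \<in> c00"
  shows "weyl_norm \<alpha> \<phi> (\<lambda>n. f n + g n) \<le> weyl_norm \<alpha> \<phi> f + weyl_norm \<alpha> \<phi> g"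
proof -
  obtain N where N: "\<And>n. n \<ge> N \<Longrightarrow> f n = 0" "\<And>n. n \<ge> N \<Longrightarrow> g n = 0"
    using c00_common_bound assms by blast
  then show ?thesis using assms
    by (simp add: weyl_norm_eq_sum[of \<alpha> N] weyl_op_add sum.distrib[symmetric] distrib_left[symmetric]
        sum_mono mult_left_mono norm_triangle_ineq)
qed

lemma weyl_norm_smult:
  assumes "\<alpha> \<ge> 0" "f \<in> c00"
  shows "weyl_norm \<alpha> \<phi> (\<lambda>n. c * f n) = cmod c * weyl_norm \<alpha> \<phi> f"
proof -
  obtain N where N: "\<And>n. n \<ge> N \<Longrightarrow> f n = 0" using c00_iff assms by blast
  then show ?thesis using assms
    by (simp add: weyl_norm_eq_sum[of \<alpha> N] weyl_op_smult norm_mult sum_distrib_left mult.left_commute)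
qed

lemma weyl_norm_diff:
  assumes "\<alpha> \<ge> 0" "\<And>n. \<phi> n \<ge> 0" "f \<in> c00" "g \<in> c00"
  shows "weyl_norm \<alpha> \<phi> (\<lambda>n. f n - g n) \<le> weyl_norm \<alpha> \<phi> f + weyl_norm \<alpha> \<phi> g"
  using weyl_norm_add[of \<alpha> \<phi> f, OF assms(1,2,3) smult_c00[OF assms(4), of "-1"]]
    weyl_norm_smult[OF assms(1,4), where \<phi> = \<phi> and c = "-1"] by simp

lemma weyl_norm_nonneg:
  assumes "\<alpha> \<ge> 0" "\<And>n. \<phi> n \<ge> 0" "f \<in> c00"
  shows "weyl_norm \<alpha> \<phi> f \<ge> 0"
proof -
  obtain N where N: "\<And>n. n \<ge> N \<Longrightarrow> f n = 0" using c00_iff assms by blast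
  then show ?thesis using assms by (simp add: weyl_norm_eq_sum[of \<alpha> N] sum_nonneg)
qed

lemma weyl_norm_zero: "\<alpha> \<ge> 0 \<Longrightarrow> weyl_norm \<alpha> \<phi> (\<lambda>n. 0) = 0"
  using weyl_norm_eq_sum[of \<alpha> 0 "\<lambda>n. 0" \<phi>] by simp

text \<open>Positive weights force every coordinate to vanish, and f is recovered from its
  coordinates by the expansion in atoms.\<close>

lemma weyl_norm_eq_0:
  assumes "\<alpha> \<ge> 0" "\<And>n. \<phi> n > 0" "f \<in> c00" "weyl_norm \<alpha> \<phi> f = 0"
  shows "f = (\<lambda>n. 0)"
proof -
  obtain N where N: "\<And>n. n \<ge> N \<Longrightarrow> f n = 0" using c00_iff assms by blast
  have "(\<Sum>n<N. \<phi> n * cmod (weyl_op (wcoef (- \<alpha>)) f n)) = 0"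
    using assms N by (simp add: weyl_norm_eq_sum[of \<alpha> N])
  then have "weyl_op (wcoef (- \<alpha>)) f n = 0" if "n < N" for n
    using that assms(2) by (subst (asm) sum_nonneg_eq_0_iff) (auto simp: less_imp_le less_le)
  then show ?thesis by (subst atom_expansion[OF N, where \<alpha> = \<alpha>]) auto
qed

lemma weyl_norm_sum_le:
  assumes "\<alpha> \<ge> 0" "\<And>n. \<phi> n \<ge> 0" "\<And>i. i \<in> I \<Longrightarrow> x i \<in> c00"
  shows "weyl_norm \<alpha> \<phi> (\<lambda>n. \<Sum>i\<in>I. c i * x i n) \<le> (\<Sum>i\<in>I. cmod (c i) * weyl_norm \<alpha> \<phi> (x i))"
  using assms(3)
proof (induction I rule: infinite_finite_induct)
  case (insert i I)
  then have "weyl_norm \<alpha> \<phi> (\<lambda>n. c i * x i n + (\<Sum>i\<in>I. c i * x i n))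
      \<le> weyl_norm \<alpha> \<phi> (\<lambda>n. c i * x i n) + weyl_norm \<alpha> \<phi> (\<lambda>n. \<Sum>i\<in>I. c i * x i n)"
    by (intro weyl_norm_add assms(1,2) smult_c00 sum_c00) auto
  with insert show ?case by (simp add: weyl_norm_smult assms)
qed (simp_all add: weyl_norm_zero assms)

text \<open>Exponents add, so the difference of order \<alpha> turns \<open>atom \<beta> p\<close>
  into \<open>atom (\<beta> - \<alpha>) p\<close>, whose entries are explicit.\<close>

lemma weyl_norm_atom:
  assumes "\<alpha> \<ge> 0"
  shows "weyl_norm \<alpha> \<phi> (atom \<beta> p) = (\<Sum>n\<le>p. \<phi> n * \<bar>wcoef (\<beta> - \<alpha>) (p - n)\<bar>)"
proof -
  have "weyl_norm \<alpha> \<phi> (atom \<beta> p) = (\<Sum>n<Suc p. \<phi> n * cmod (weyl_op (wcoef (- \<alpha>)) (atom \<beta> p) n))"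
    using assms by (intro weyl_norm_eq_sum) (simp_all add: atom_def)
  then show ?thesis unfolding lessThan_Suc_atMost by (simp add: weyl_op_atom atom_def)
qed

lemma weyl_norm_atom_self: "\<alpha> \<ge> 0 \<Longrightarrow> weyl_norm \<alpha> \<phi> (atom \<alpha> p) = \<phi> p"
proof -
  assume "\<alpha> \<ge> 0"
  then have "weyl_norm \<alpha> \<phi> (atom \<alpha> p) = (\<Sum>n\<le>p. if n = p then \<phi> n else 0)"
    unfolding weyl_norm_atom[OF \<open>\<alpha> \<ge> 0\<close>] by (intro sum.cong) (auto simp: wcoef_zero)
  then show ?thesis by simp
qed

text \<open>The norm on the right is a weighted l1 norm of the coordinates in the basis
  \<open>atom \<beta> p\<close>; expanding f in this basis, the triangle inequality for the norm on
  the left leaves only the basis vectors to be checked.\<close>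

lemma weyl_norm_le_atoms:
  assumes "\<alpha> \<ge> 0" "\<And>n. \<phi> n \<ge> 0" "\<beta> \<ge> 0"
    and atom: "\<And>p. weyl_norm \<alpha> \<phi> (atom \<beta> p) \<le> C * \<psi> p" and "f \<in> c00"
  shows "weyl_norm \<alpha> \<phi> f \<le> C * weyl_norm \<beta> \<psi> f"
proof -
  obtain N where N: "\<And>n. n \<ge> N \<Longrightarrow> f n = 0" using c00_iff assms by blast
  define F where "F = weyl_op (wcoef (- \<beta>)) f"
  have "weyl_norm \<alpha> \<phi> f = weyl_norm \<alpha> \<phi> (\<lambda>n. \<Sum>p<N. F p * atom \<beta> p n)"
    unfolding F_def using atom_expansion[OF N, where \<alpha> = \<beta>] by simp
  also have "\<dots> \<le> (\<Sum>p<N. cmod (F p) * weyl_norm \<alpha> \<phi> (atom \<beta> p))"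
    by (intro weyl_norm_sum_le assms atom_c00)
  also have "\<dots> \<le> (\<Sum>p<N. cmod (F p) * (C * \<psi> p))"
    by (intro sum_mono mult_left_mono atom) auto
  also have "\<dots> = C * weyl_norm \<beta> \<psi> f"
    by (simp add: F_def weyl_norm_eq_sum[OF \<open>\<beta> \<ge> 0\<close> N] sum_distrib_left mult_ac)
  finally show ?thesis .
qed

section \<open>Boundedness of convolution\<close>

lemma weyl_norm_conv_le_atoms:
  assumes "\<alpha> \<ge> 0" "\<And>n. \<phi> n \<ge> 0"
    and atom: "\<And>j p. weyl_norm \<alpha> \<phi> (conv (atom \<alpha> j) (atom \<alpha> p)) \<le> C * \<phi> j * \<phi> p"
    and fg: "f \<in> c00" "g \<in> c00"
  shows "weyl_norm \<alpha> \<phi> (conv f g) \<le> C * weyl_norm \<alpha> \<phi> f * weyl_norm \<alpha> \<phi> g"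
proof -
  obtain N where N: "\<And>n. n \<ge> N \<Longrightarrow> f n = 0" "\<And>n. n \<ge> N \<Longrightarrow> g n = 0"
    using c00_common_bound fg by blast
  define F where "F = weyl_op (wcoef (- \<alpha>)) f"
  define G where "G = weyl_op (wcoef (- \<alpha>)) g"
  have "f = (\<lambda>n. \<Sum>p<N. F p * atom \<alpha> p n)" "g = (\<lambda>n. \<Sum>p<N. G p * atom \<alpha> p n)"
    unfolding F_def G_def by (rule atom_expansion; fact N)+
  then have "conv f g = (\<lambda>n. \<Sum>x\<in>{..<N} \<times> {..<N}.
      (F (fst x) * G (snd x)) * conv (atom \<alpha> (fst x)) (atom \<alpha> (snd x)) n)"
    using conv_sum_sum[of F "atom \<alpha>" "{..<N}" G "atom \<alpha>" "{..<N}"] by (simp add: case_prod_beta)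
  then have "weyl_norm \<alpha> \<phi> (conv f g) \<le> (\<Sum>x\<in>{..<N} \<times> {..<N}.
      cmod (F (fst x) * G (snd x)) * weyl_norm \<alpha> \<phi> (conv (atom \<alpha> (fst x)) (atom \<alpha> (snd x))))"
    by (simp only:) (intro weyl_norm_sum_le assms conv_c00 atom_c00)
  also have "\<dots> \<le> (\<Sum>x\<in>{..<N} \<times> {..<N}. 
      cmod (F (fst x) * G (snd x)) * (C * \<phi> (fst x) * \<phi> (snd x)))"
    by (intro sum_mono mult_left_mono atom) auto
  also have "\<dots> = C * (\<Sum>j<N. \<phi> j * cmod (F j)) * (\<Sum>p<N. \<phi> p * cmod (G p))"
    by (simp add: mult.assoc sum_product sum.cartesian_product sum_distrib_left case_prod_beta norm_mult mult_ac)
  also have "\<dots> = C * weyl_norm \<alpha> \<phi> f * weyl_norm \<alpha> \<phi> g"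
    by (simp add: F_def G_def weyl_norm_eq_sum[OF \<open>\<alpha> \<ge> 0\<close> N(1)] weyl_norm_eq_sum[OF \<open>\<alpha> \<ge> 0\<close> N(2)])
  finally show ?thesis .
qed

text \<open>Triangle inequality in \<open>conv_atom\<close>: the coefficients are nonnegative, each
  atom has norm equal to its weight, and the minus sign between the two sums becomes a plus.\<close>

lemma weyl_norm_conv_atom_le:
  assumes "\<alpha> \<ge> 0" "\<And>n. \<phi> n \<ge> 0"
  shows "weyl_norm \<alpha> \<phi> (conv (atom \<alpha> j) (atom \<alpha> p))
    \<le> (\<Sum>n=0..j. wcoef \<alpha> n * \<phi> (j + p - n)) + (\<Sum>n=p+1..j+p. wcoef \<alpha> n * \<phi> (j + p - n))"
proof -
  have "weyl_norm \<alpha> \<phi> (\<lambda>m. \<Sum>l\<in>I. of_real (wcoef \<alpha> l) * atom \<alpha> (j + p - l) m)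
      \<le> (\<Sum>n\<in>I. wcoef \<alpha> n * \<phi> (j + p - n))" for I
    using weyl_norm_sum_le[of \<alpha> \<phi> I "\<lambda>l. atom \<alpha> (j + p - l)" "\<lambda>l. of_real (wcoef \<alpha> l)"] assms
    by (simp add: atom_c00 weyl_norm_atom_self wcoef_nonneg)
  note this[of "{0..j}"] this[of "{p+1..j+p}"]
  moreover have "weyl_norm \<alpha> \<phi> (conv (atom \<alpha> j) (atom \<alpha> p)) 
      \<le> weyl_norm \<alpha> \<phi> (\<lambda>m. \<Sum>l=0..j. of_real (wcoef \<alpha> l) * atom \<alpha> (j + p - l) m)
      + weyl_norm \<alpha> \<phi> (\<lambda>m. \<Sum>l=p+1..j+p. of_real (wcoef \<alpha> l) * atom \<alpha> (j + p - l) m)"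
    unfolding conv_atom atLeast0AtMost by (intro weyl_norm_diff assms sum_c00 atom_c00)
  ultimately show ?thesis by simp
qed

text \<open>The weight condition covers 1 \<le> j \<le> p. Commutativity gives j > p; for j = 0 the
  bound for the product of atoms is just \<phi>(p), so that \<open>1 \<le> C * \<phi> 0\<close>
  suffices.\<close>

lemma weyl_norm_conv_le:
  assumes "\<alpha> \<ge> 0" "\<And>n. \<phi> n \<ge> 0" "1 \<le> C * \<phi> 0"
    and omega: "\<And>j p. 1 \<le> j \<Longrightarrow> j \<le> p \<Longrightarrow> (\<Sum>n=0..j. wcoef \<alpha> n * \<phi> (j + p - n))
       + (\<Sum>n=p+1..j+p. wcoef \<alpha> n * \<phi> (j + p - n)) \<le> C * \<phi> j * \<phi> p"
    and fg: "f \<in> c00" "g \<in> c00"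
  shows "weyl_norm \<alpha> \<phi> (conv f g) \<le> C * weyl_norm \<alpha> \<phi> f * weyl_norm \<alpha> \<phi> g"
proof -
  have le: "weyl_norm \<alpha> \<phi> (conv (atom \<alpha> j) (atom \<alpha> p)) \<le> C * \<phi> j * \<phi> p" if "j \<le> p" for j p
  proof (cases "j = 0")
    case True
    have "\<phi> p \<le> C * \<phi> 0 * \<phi> p" using mult_right_mono[OF assms(3) assms(2)[of p]] by simp
    then show ?thesis using weyl_norm_conv_atom_le[of \<alpha> \<phi> j p, OF assms(1,2)] True by simp
  next
    case False
    then show ?thesis using weyl_norm_conv_atom_le[of \<alpha> \<phi> j p, OF assms(1,2)] omega[of j p] that by linarith
  qed
  have "weyl_norm \<alpha> \<phi> (conv (atom \<alpha> j) (atom \<alpha> p)) \<le> C * \<phi> j * \<phi> p" for j p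
    using le[of j p] le[of p j] conv_commute[of "atom \<alpha> j" "atom \<alpha> p"] 
    by (cases "j \<le> p") (auto simp: mult_ac)
  then show ?thesis by (rule weyl_norm_conv_le_atoms[OF assms(1,2) _ fg])
qed

lemma omega_loc_pos: "\<phi> \<in> omega_loc \<alpha> \<Longrightarrow> 0 < \<phi> n"
  by (simp add: omega_loc_def)

lemma omega_loc_conv_bounded:
  assumes "\<alpha> > 0" "\<phi> \<in> omega_loc \<alpha>"
  shows "\<exists>C>0. \<forall>f\<in>c00. \<forall>g\<in>c00. weyl_norm \<alpha> \<phi> (conv f g) \<le> C * weyl_norm \<alpha> \<phi> f * weyl_norm \<alpha> \<phi> g"
proof -
  have pos: "\<phi> n > 0" for n using assms omega_loc_pos by blast
  obtain c where c: "c > 0" "\<And>j p. 1 \<le> j \<Longrightarrow> j \<le> p \<Longrightarrow> (\<Sum>n=0..j. wcoef \<alpha> n * \<phi> (j + p - n))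
       + (\<Sum>n=p+1..j+p. wcoef \<alpha> n * \<phi> (j + p - n)) \<le> c * \<phi> j * \<phi> p"
    using assms unfolding omega_loc_def by (auto simp: cesaro_eq_wcoef)
  \<comment> \<open>The term 1 / \<phi>(0) provides for products with the atom of index 0, which the
    weight condition does not cover.\<close>
  define C where "C = c + 1 / \<phi> 0"
  have "weyl_norm \<alpha> \<phi> (conv f g) \<le> C * weyl_norm \<alpha> \<phi> f * weyl_norm \<alpha> \<phi> g"
    if "f \<in> c00" "g \<in> c00" for f g
  proof (rule weyl_norm_conv_le[OF _ _ _ _ that])
    have le: "c * \<phi> j * \<phi> p \<le> C * \<phi> j * \<phi> p" for j p
      using pos by (intro mult_right_mono) (auto simp: C_def less_imp_le)
    show "(\<Sum>n=0..j. wcoef \<alpha> n * \<phi> (j + p - n))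
       + (\<Sum>n=p+1..j+p. wcoef \<alpha> n * \<phi> (j + p - n)) \<le> C * \<phi> j * \<phi> p" if "1 \<le> j" "j \<le> p" for j p
      by (rule order_trans[OF c(2)[OF that] le])
    show "1 \<le> C * \<phi> 0" using pos[of 0] c(1) by (simp add: C_def distrib_right)
  qed (use assms pos in \<open>auto simp: less_imp_le\<close>)
  moreover have "C > 0" using c(1) pos[of 0] by (simp add: C_def add_pos_pos)
  ultimately show ?thesis by blast
qed

section \<open>Comparison of the norms of different orders\<close>

lemma weyl_norm_wcoef_mono:
  assumes "0 \<le> \<alpha>" "\<alpha> \<le> \<beta>" "f \<in> c00"
  shows "weyl_norm \<alpha> (wcoef (\<alpha> + 1)) f \<le> weyl_norm \<beta> (wcoef (\<beta> + 1)) f"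
proof -
  \<comment> \<open>The entries of the differenced atom are nonnegative since \<beta> \<ge>
    \<alpha>, so the norm is a Cauchy product of coefficient sequences and their exponents add.
    Equality on the basis yields the constant 1.\<close>
  have "weyl_norm \<alpha> (wcoef (\<alpha> + 1)) (atom \<beta> p) = wcoef (\<beta> + 1) p" for p
    using assms wcoef_convolution[of "\<alpha> + 1" "\<beta> - \<alpha>" p] by (simp add: weyl_norm_atom wcoef_nonneg add.commute)
  then show ?thesis
    using weyl_norm_le_atoms[of \<alpha> "wcoef (\<alpha> + 1)" \<beta> 1 "wcoef (\<beta> + 1)" f] assms by (simp add: wcoef_nonneg)
qed

text \<open>With exponent 0 the definition of \<^const>\<open>weyl_diff\<close> still makes sense (there \<open>m = 1\<close>) and
  gives the identity, so \<open>\<ell>\<^sup>1\<close> is the case \<open>\<alpha> = 0\<close> of the scale.\<close>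

lemma l1_norm_eq_weyl_norm: "f \<in> c00 \<Longrightarrow> l1_norm f = weyl_norm 0 (wcoef 1) f"
  by (simp add: l1_norm_def weyl_norm_def weyl_diff_eq_weyl_op weyl_op_wcoef_zero wcoef_1)

lemma l1_norm_le_weyl_norm:
  "0 \<le> \<alpha> \<Longrightarrow> f \<in> c00 \<Longrightarrow> l1_norm f \<le> weyl_norm \<alpha> (wcoef (\<alpha> + 1)) f"
  using weyl_norm_wcoef_mono[of 0 \<alpha> f] by (simp add: l1_norm_eq_weyl_norm)

lemma c00_summable: "f \<in> c00 \<Longrightarrow> summable (\<lambda>n. cmod (f n))"
  by (rule summable_finite[of "{n. f n \<noteq> 0}"]) (auto simp: c00_def)

text \<open>The coefficients \<open>wcoef (- \<alpha>)\<close> are bounded, so each coordinate of f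
  depends l1-continuously on f, with one constant for all n.\<close>

lemma weyl_op_bound_l1:
  assumes "\<alpha> \<ge> 0"
  obtains B where "B > 0" "\<And>f n. f \<in> c00 \<Longrightarrow> cmod (weyl_op (wcoef (- \<alpha>)) f n) \<le> B * l1_norm f"
proof -
  obtain B where B: "B > 0" "\<And>n. \<bar>wcoef (- \<alpha>) n\<bar> \<le> B"
    using wcoef_bounded[of "- \<alpha>"] assms by auto
  have "cmod (weyl_op (wcoef (- \<alpha>)) f n) \<le> B * l1_norm f" if f: "f \<in> c00" for f n
  proof -
    obtain N where N: "\<And>n. n \<ge> N \<Longrightarrow> f n = 0" using c00_iff f by blast
    have "l1_norm f = (\<Sum>n<N. cmod (f n))"
      unfolding l1_norm_def by (rule suminf_finite) (simp_all add: N)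
    moreover have le: "cmod ((if n \<le> j then of_real (wcoef (- \<alpha>) (j - n)) else 0) * f j) \<le> B * cmod (f j)" for j
      using B(1) mult_right_mono[OF B(2), of "cmod (f j)"] by (auto simp: norm_mult)
    have "cmod (weyl_op (wcoef (- \<alpha>)) f n) \<le> (\<Sum>j<N. B * cmod (f j))"
      by (subst weyl_op_eq_sum[OF N], assumption) (rule sum_norm_le, rule le)
    ultimately show ?thesis by (simp add: sum_distrib_left)
  qed
  with B(1) show thesis using that by blast
qed

text \<open>Fatou's lemma for series: each partial sum of the limit is a limit of partial sums,
  which are eventually bounded by c.\<close>

lemma suminf_le_of_pointwise_limit:
  fixes u :: "nat \<Rightarrow> nat \<Rightarrow> real"
  assumes lim: "\<And>n. (\<lambda>j. u j n) \<longlonglongrightarrow> v n" and nonneg: "\<And>j n. u j n \<ge> 0"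
    and summ: "\<And>j. summable (u j)" and le: "eventually (\<lambda>j. suminf (u j) \<le> c) sequentially"
  shows "summable v" "suminf v \<le> c"
proof -
  have v: "v n \<ge> 0" for n using LIMSEQ_le_const[OF lim] nonneg by blast
  have *: "sum v {..<K} \<le> c" for K
  proof (rule tendsto_upperbound)
    show "(\<lambda>j. sum (u j) {..<K}) \<longlonglongrightarrow> sum v {..<K}" by (intro tendsto_sum lim)
    show "eventually (\<lambda>j. sum (u j) {..<K} \<le> c) sequentially"
      using le by eventually_elim (meson nonneg order_trans sum_le_suminf summ finite_lessThan)
  qed simp
  show "summable v" by (rule summableI_nonneg_bounded[of _ c]) (use v * in auto)
  then show "suminf v \<le> c" using * by (intro suminf_le_const) auto
qed

section \<open>Completion of normed modules and algebras\<close>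

lemma ring_of_type_algebra_simps [simp]:
  "carrier ring_of_type_algebra = UNIV" "x \<oplus>\<^bsub>ring_of_type_algebra\<^esub> y = x + y"
  "x \<otimes>\<^bsub>ring_of_type_algebra\<^esub> y = x * y" "\<one>\<^bsub>ring_of_type_algebra\<^esub> = 1" "\<zero>\<^bsub>ring_of_type_algebra\<^esub> = 0"
  by (simp_all add: ring_of_type_algebra_def)

text \<open>Negation has no formula of its own in \<open>completion\<close> or
  \<open>seq_algebra\<close>; writing it as multiplication by -1 reduces it to the scalar operation
  given there.\<close>

lemma module_minus_eq_smult:
  fixes M :: "(complex, 'a, 'b) module_scheme"
  assumes "module ring_of_type_algebra M" "x \<in> carrier M"
  shows "\<ominus>\<^bsub>M\<^esub> x = (-1) \<odot>\<^bsub>M\<^esub> x"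
proof -
  interpret M: module ring_of_type_algebra M by fact
  have "(-1) \<odot>\<^bsub>M\<^esub> x \<oplus>\<^bsub>M\<^esub> x = \<zero>\<^bsub>M\<^esub>"
    using M.smult_l_distr[of "-1" 1 x] M.smult_one[OF assms(2)] M.smult_l_null[OF assms(2)] assms(2) by simp
  then show ?thesis using assms(2) M.smult_closed[of "-1" x] by (simp add: M.M.minus_equality)
qed

section \<open>The metric of a normed module and its Cauchy sequences\<close>

locale normed_module =
  fixes A :: "'a normed_module"
  assumes normed: "normed_space A"
begin

lemma module: "module ring_of_type_algebra A"
  using normed by (simp add: normed_space_def)

sublocale M: module ring_of_type_algebra A
  by (rule module)

abbreviation dist_A where "dist_A \<equiv> nrm_dist A"

lemma nrm_nonneg: "x \<in> carrier A \<Longrightarrow> 0 \<le> nrm A x"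
  and nrm_eq_0: "x \<in> carrier A \<Longrightarrow> nrm A x = 0 \<longleftrightarrow> x = \<zero>\<^bsub>A\<^esub>"
  and nrm_smult: "x \<in> carrier A \<Longrightarrow> nrm A (c \<odot>\<^bsub>A\<^esub> x) = cmod c * nrm A x"
  and nrm_triangle: "x \<in> carrier A \<Longrightarrow> y \<in> carrier A \<Longrightarrow> nrm A (x \<oplus>\<^bsub>A\<^esub> y) \<le> nrm A x + nrm A y"
  using normed by (auto simp: normed_space_def)

lemma smult_closed [simp]: "x \<in> carrier A \<Longrightarrow> c \<odot>\<^bsub>A\<^esub> x \<in> carrier A"
  by (simp add: M.smult_closed)

lemma dist_eq: "x \<in> carrier A \<Longrightarrow> y \<in> carrier A \<Longrightarrow> dist_A x y = nrm A (x \<ominus>\<^bsub>A\<^esub> y)"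
  by (simp add: nrm_dist_def)

lemma minus_diff:
  assumes "x \<in> carrier A" "y \<in> carrier A"
  shows "\<ominus>\<^bsub>A\<^esub> (x \<ominus>\<^bsub>A\<^esub> y) = y \<ominus>\<^bsub>A\<^esub> x"
  using assms by (simp add: M.M.minus_eq M.M.minus_add M.M.a_comm)

lemma nrm_minus: "x \<in> carrier A \<Longrightarrow> nrm A (\<ominus>\<^bsub>A\<^esub> x) = nrm A x"
  by (simp add: module_minus_eq_smult[OF module] nrm_smult)

lemma dist_commute: "dist_A x y = dist_A y x"
  unfolding nrm_dist_def using nrm_minus[of "x \<ominus>\<^bsub>A\<^esub> y"] minus_diff[of x y] by auto

lemma diff_trans:
  assumes "x \<in> carrier A" "y \<in> carrier A" "z \<in> carrier A"
  shows "(x \<ominus>\<^bsub>A\<^esub> y) \<oplus>\<^bsub>A\<^esub> (y \<ominus>\<^bsub>A\<^esub> z) = x \<ominus>\<^bsub>A\<^esub> z"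
  using assms by (simp add: M.M.minus_eq M.M.a_assoc M.M.r_neg1)

lemma dist_triangle:
  assumes "x \<in> carrier A" "y \<in> carrier A" "z \<in> carrier A"
  shows "dist_A x z \<le> dist_A x y + dist_A y z"
  using nrm_triangle[of "x \<ominus>\<^bsub>A\<^esub> y" "y \<ominus>\<^bsub>A\<^esub> z"] assms by (simp add: dist_eq diff_trans)

lemma dist_nonneg: "0 \<le> dist_A x y"
  by (simp add: nrm_dist_def nrm_nonneg)

lemma diff_eq_zero_iff:
  assumes "x \<in> carrier A" "y \<in> carrier A"
  shows "x \<ominus>\<^bsub>A\<^esub> y = \<zero>\<^bsub>A\<^esub> \<longleftrightarrow> x = y"
  using assms M.M.minus_equality[of x "\<ominus>\<^bsub>A\<^esub> y"] by (auto simp: M.M.minus_eq M.M.r_neg)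

lemma dist_eq_0: "x \<in> carrier A \<Longrightarrow> y \<in> carrier A \<Longrightarrow> dist_A x y = 0 \<longleftrightarrow> x = y"
  by (simp add: dist_eq nrm_eq_0 diff_eq_zero_iff)

lemma dist_self: "dist_A x x = 0"
  by (simp add: nrm_dist_def M.M.r_neg M.M.minus_eq nrm_eq_0)

lemma dist_zero: "x \<in> carrier A \<Longrightarrow> dist_A x \<zero>\<^bsub>A\<^esub> = nrm A x"
  by (simp add: dist_eq M.M.minus_eq M.smult_r_null module_minus_eq_smult[OF module])

sublocale metric: Metric_space "carrier A" dist_A
  by unfold_locales (simp_all add: dist_nonneg dist_commute dist_eq_0 dist_triangle)

lemma nrm_diff_le_dist:
  assumes "x \<in> carrier A" "y \<in> carrier A"
  shows "\<bar>nrm A x - nrm A y\<bar> \<le> dist_A x y"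
  using assms dist_triangle[of x y "\<zero>\<^bsub>A\<^esub>"] dist_triangle[of y x "\<zero>\<^bsub>A\<^esub>"] dist_commute[of x y]
  by (simp add: dist_zero)

lemma dist_add_le:
  assumes "x \<in> carrier A" "y \<in> carrier A" "x' \<in> carrier A" "y' \<in> carrier A"
  shows "dist_A (x \<oplus>\<^bsub>A\<^esub> y) (x' \<oplus>\<^bsub>A\<^esub> y') \<le> dist_A x x' + dist_A y y'"
proof -
  have "(x \<oplus>\<^bsub>A\<^esub> y) \<ominus>\<^bsub>A\<^esub> (x' \<oplus>\<^bsub>A\<^esub> y') = (x \<ominus>\<^bsub>A\<^esub> x') \<oplus>\<^bsub>A\<^esub> (y \<ominus>\<^bsub>A\<^esub> y')"
    using assms by (simp add: M.M.minus_eq M.M.minus_add M.M.a_ac)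
  then show ?thesis using assms nrm_triangle[of "x \<ominus>\<^bsub>A\<^esub> x'" "y \<ominus>\<^bsub>A\<^esub> y'"] by (simp add: dist_eq)
qed

lemma dist_smult:
  assumes "x \<in> carrier A" "y \<in> carrier A"
  shows "dist_A (c \<odot>\<^bsub>A\<^esub> x) (c \<odot>\<^bsub>A\<^esub> y) = cmod c * dist_A x y"
proof -
  have "c \<odot>\<^bsub>A\<^esub> x \<ominus>\<^bsub>A\<^esub> c \<odot>\<^bsub>A\<^esub> y = c \<odot>\<^bsub>A\<^esub> (x \<ominus>\<^bsub>A\<^esub> y)"
    using assms by (simp add: M.M.minus_eq M.smult_r_distr M.smult_r_minus)
  then show ?thesis using assms by (simp add: dist_eq nrm_smult)
qed

text \<open>As a limit along the product filter the Cauchy condition becomes accessible to the rules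
  for sums, products and domination of limits, which replace most epsilon arguments below.\<close>

lemma cauchy_seqs_iff:
  "F \<in> cauchy_seqs A \<longleftrightarrow> (\<forall>i. F i \<in> carrier A) \<and>
    ((\<lambda>p. dist_A (F (fst p)) (F (snd p))) \<longlongrightarrow> 0) (sequentially \<times>\<^sub>F sequentially)"
proof -
  have "((\<lambda>p. dist_A (F (fst p)) (F (snd p))) \<longlongrightarrow> 0) (sequentially \<times>\<^sub>F sequentially)
      \<longleftrightarrow> (\<forall>e>0. \<exists>N. \<forall>m\<ge>N. \<forall>n\<ge>N. dist_A (F n) (F m) < e)"
    by (simp add: tendsto_iff eventually_prod_sequentially dist_nonneg)
  also have "\<dots> \<longleftrightarrow> (\<forall>e>0. \<exists>N. \<forall>n n'. N \<le> n \<longrightarrow> N \<le> n' \<longrightarrow> dist_A (F n) (F n') < e)"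
    by meson
  finally show ?thesis
    by (simp add: cauchy_seqs_def metric.MCauchy_def image_subset_iff)
qed

lemma cauchy_seqs_closed: "F \<in> cauchy_seqs A \<Longrightarrow> F i \<in> carrier A"
  by (simp add: cauchy_seqs_iff)

lemma cauchy_seqsD:
  "F \<in> cauchy_seqs A \<Longrightarrow> ((\<lambda>p. dist_A (F (fst p)) (F (snd p))) \<longlongrightarrow> 0) (sequentially \<times>\<^sub>F sequentially)"
  by (simp add: cauchy_seqs_iff)

lemma cauchy_seqs_const: "x \<in> carrier A \<Longrightarrow> (\<lambda>i. x) \<in> cauchy_seqs A"
  by (simp add: cauchy_seqs_iff dist_self)

lemma cauchy_seqs_add:
  assumes "F \<in> cauchy_seqs A" "G \<in> cauchy_seqs A"
  shows "(\<lambda>i. F i \<oplus>\<^bsub>A\<^esub> G i) \<in> cauchy_seqs A"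
proof -
  have "((\<lambda>p. dist_A (F (fst p)) (F (snd p)) + dist_A (G (fst p)) (G (snd p))) \<longlongrightarrow> 0) (sequentially \<times>\<^sub>F sequentially)"
    using tendsto_add[OF cauchy_seqsD[OF assms(1)] cauchy_seqsD[OF assms(2)]] by simp
  then have "((\<lambda>p. dist_A (F (fst p) \<oplus>\<^bsub>A\<^esub> G (fst p)) (F (snd p) \<oplus>\<^bsub>A\<^esub> G (snd p))) \<longlongrightarrow> 0) (sequentially \<times>\<^sub>F sequentially)"
    by (rule tendsto_0_le[where K = 1])
      (use assms in \<open>auto simp: dist_nonneg dist_add_le cauchy_seqs_closed intro!: always_eventually\<close>)
  then show ?thesis using assms by (simp add: cauchy_seqs_iff)
qed

lemma cauchy_seqs_smult:
  assumes "F \<in> cauchy_seqs A"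
  shows "(\<lambda>i. c \<odot>\<^bsub>A\<^esub> F i) \<in> cauchy_seqs A"
  using assms tendsto_mult_left[OF cauchy_seqsD[OF assms], of "cmod c"]
  by (simp add: cauchy_seqs_iff dist_smult)

lemma nrm_convergent:
  assumes "F \<in> cauchy_seqs A"
  shows "convergent (\<lambda>i. nrm A (F i))"
proof -
  have "Cauchy (\<lambda>i. nrm A (F i))"
  proof (rule CauchyI)
    fix e :: real assume "e > 0"
    then have "eventually (\<lambda>p. dist_A (F (fst p)) (F (snd p)) < e) (sequentially \<times>\<^sub>F sequentially)"
      using order_tendstoD(2)[OF cauchy_seqsD[OF assms]] by auto
    then obtain M where M: "\<And>m n. m \<ge> M \<Longrightarrow> n \<ge> M \<Longrightarrow> dist_A (F m) (F n) < e"
      unfolding eventually_prod_sequentially by auto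
    have "norm (nrm A (F m) - nrm A (F n)) < e" if "m \<ge> M" "n \<ge> M" for m n
      using M[OF that] nrm_diff_le_dist[OF cauchy_seqs_closed[OF assms] cauchy_seqs_closed[OF assms], of m n]
      by simp
    then show "\<exists>M. \<forall>m\<ge>M. \<forall>n\<ge>M. norm (nrm A (F m) - nrm A (F n)) < e" by blast
  qed
  then show ?thesis by (simp add: Cauchy_convergent_iff)
qed

section \<open>Classes of Cauchy sequences and the operations on them\<close>

lemma null_diff_iff:
  "(F, G) \<in> null_diff A \<longleftrightarrow> F \<in> cauchy_seqs A \<and> G \<in> cauchy_seqs A \<and> (\<lambda>i. dist_A (F i) (G i)) \<longlonglongrightarrow> 0"
  by (simp add: null_diff_def)

lemma equiv_null_diff: "equiv (cauchy_seqs A) (null_diff A)"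
proof (rule equivI)
  show "trans (null_diff A)"
  proof (rule transI)
    fix F G H assume *: "(F, G) \<in> null_diff A" "(G, H) \<in> null_diff A"
    then have "(\<lambda>i. dist_A (F i) (G i) + dist_A (G i) (H i)) \<longlonglongrightarrow> 0"
      unfolding null_diff_iff using tendsto_add_zero by blast
    then have "(\<lambda>i. dist_A (F i) (H i)) \<longlonglongrightarrow> 0"
      by (rule tendsto_0_le[where K = 1]) 
        (use * in \<open>auto simp: null_diff_iff dist_nonneg dist_triangle cauchy_seqs_closed\<close>)
    with * show "(F, H) \<in> null_diff A" by (simp add: null_diff_iff)
  qed
  show "sym (null_diff A)" by (auto simp: sym_def null_diff_iff dist_commute)
  show "refl_on (cauchy_seqs A) (null_diff A)" by (simp add: refl_on_def null_diff_iff dist_self)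
  show "null_diff A \<subseteq> cauchy_seqs A \<times> cauchy_seqs A" by (auto simp: null_diff_iff)
qed

definition cls :: "(nat \<Rightarrow> 'a) \<Rightarrow> (nat \<Rightarrow> 'a) set" where
  "cls F = null_diff A `` {F}"

lemma cls_eq_iff:
  "F \<in> cauchy_seqs A \<Longrightarrow> G \<in> cauchy_seqs A \<Longrightarrow> cls F = cls G \<longleftrightarrow> (\<lambda>i. dist_A (F i) (G i)) \<longlonglongrightarrow> 0"
  unfolding cls_def using equiv_class_eq_iff[OF equiv_null_diff, of F G] by (simp add: null_diff_iff)

lemma mem_cls_iff: "F \<in> cauchy_seqs A \<Longrightarrow> G \<in> cls F \<longleftrightarrow> (G \<in> cauchy_seqs A \<and> (\<lambda>i. dist_A (F i) (G i)) \<longlonglongrightarrow> 0)"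
  by (simp add: cls_def null_diff_iff)

lemma completion_carrier: "carrier (completion A) = cls ` cauchy_seqs A"
  by (auto simp: completion_def quotient_def cls_def)

lemma cls_closed: "F \<in> cauchy_seqs A \<Longrightarrow> cls F \<in> carrier (completion A)"
  by (simp add: completion_carrier)

lemma carrierE:
  assumes "P \<in> carrier (completion A)"
  obtains F where "F \<in> cauchy_seqs A" "P = cls F"
  using assms by (auto simp: completion_carrier)

lemma completion_zero: "\<zero>\<^bsub>completion A\<^esub> = cls (\<lambda>i. \<zero>\<^bsub>A\<^esub>)"
  and completion_one: "\<one>\<^bsub>completion A\<^esub> = cls (\<lambda>i. \<one>\<^bsub>A\<^esub>)"
  and completion_embed: "completion_embed A x = cls (\<lambda>i. x)"
  by (simp_all add: completion_def completion_embed_def cls_def)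

text \<open>Termwise addition respects null differences, so the double union in
  \<open>completion\<close> collapses to a single class.\<close>

lemma completion_add:
  assumes "F \<in> cauchy_seqs A" "G \<in> cauchy_seqs A"
  shows "cls F \<oplus>\<^bsub>completion A\<^esub> cls G = cls (\<lambda>i. F i \<oplus>\<^bsub>A\<^esub> G i)"
proof -
  have "(\<lambda>F G. cls (\<lambda>i. F i \<oplus>\<^bsub>A\<^esub> G i)) respects2 null_diff A"
  proof (rule congruent2I')
    fix F F' G G' assume *: "(F, F') \<in> null_diff A" "(G, G') \<in> null_diff A"
    then have "(\<lambda>i. dist_A (F i) (F' i) + dist_A (G i) (G' i)) \<longlonglongrightarrow> 0"
      unfolding null_diff_iff using tendsto_add_zero by blast
    then have "(\<lambda>i. dist_A (F i \<oplus>\<^bsub>A\<^esub> G i) (F' i \<oplus>\<^bsub>A\<^esub> G' i)) \<longlonglongrightarrow> 0"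
      by (rule tendsto_0_le[where K = 1]) 
        (use * in \<open>auto simp: null_diff_iff dist_nonneg dist_add_le cauchy_seqs_closed\<close>)
    with * show "cls (\<lambda>i. F i \<oplus>\<^bsub>A\<^esub> G i) = cls (\<lambda>i. F' i \<oplus>\<^bsub>A\<^esub> G' i)"
      by (simp add: cls_eq_iff cauchy_seqs_add null_diff_iff)
  qed
  from UN_equiv_class2[OF equiv_null_diff equiv_null_diff this assms] show ?thesis
    by (simp add: completion_def cls_def)
qed

lemma completion_smult:
  assumes "F \<in> cauchy_seqs A"
  shows "c \<odot>\<^bsub>completion A\<^esub> cls F = cls (\<lambda>i. c \<odot>\<^bsub>A\<^esub> F i)"
proof -
  have "(\<lambda>F. cls (\<lambda>i. c \<odot>\<^bsub>A\<^esub> F i)) respects null_diff A"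
  proof (rule congruentI)
    fix F F' assume *: "(F, F') \<in> null_diff A"
    then have "(\<lambda>i. cmod c * dist_A (F i) (F' i)) \<longlonglongrightarrow> 0"
      unfolding null_diff_iff using tendsto_mult_right_zero by blast
    with * show "cls (\<lambda>i. c \<odot>\<^bsub>A\<^esub> F i) = cls (\<lambda>i. c \<odot>\<^bsub>A\<^esub> F' i)"
      by (simp add: cls_eq_iff cauchy_seqs_smult null_diff_iff dist_smult cauchy_seqs_closed)
  qed
  from UN_equiv_class[OF equiv_null_diff this assms] show ?thesis
    by (simp add: completion_def cls_def)
qed

text \<open>The norms along F form a real Cauchy sequence, and all representatives share its limit;
  this justifies the definite description. In this form, inequalities between norms carry over to
  the completion by passing to the limit.\<close>

lemma completion_nrm:
  assumes "F \<in> cauchy_seqs A"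
  shows "(\<lambda>i. nrm A (F i)) \<longlonglongrightarrow> nrm (completion A) (cls F)"
proof -
  obtain r where r: "(\<lambda>i. nrm A (F i)) \<longlonglongrightarrow> r"
    using nrm_convergent[OF assms] by (auto simp: convergent_def)
  have all: "\<forall>G\<in>cls F. (\<lambda>i. nrm A (G i)) \<longlonglongrightarrow> r"
  proof
    fix G assume "G \<in> cls F"
    then have G: "G \<in> cauchy_seqs A" "(\<lambda>i. dist_A (F i) (G i)) \<longlonglongrightarrow> 0" by (simp_all add: mem_cls_iff assms)
    have "(\<lambda>i. nrm A (G i) - nrm A (F i)) \<longlonglongrightarrow> 0"
      by (rule tendsto_0_le[OF G(2), where K = 1])
        (use G assms nrm_diff_le_dist in \<open>auto simp: dist_nonneg cauchy_seqs_closed abs_minus_commute\<close>)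
    from tendsto_add[OF r this] show "(\<lambda>i. nrm A (G i)) \<longlonglongrightarrow> r" by simp
  qed
  have F: "F \<in> cls F" using assms by (simp add: mem_cls_iff dist_self)
  have "nrm (completion A) (cls F) = (THE r. \<forall>G\<in>cls F. (\<lambda>i. nrm A (G i)) \<longlonglongrightarrow> r)"
    by (simp add: completion_def)
  also have "\<dots> = r" by (rule the_equality) (use all F r LIMSEQ_unique in blast)+
  finally show ?thesis using r by simp
qed

lemma completion_abelian_group: "abelian_group (completion A)"
proof (rule abelian_groupI)
  fix P assume "P \<in> carrier (completion A)"
  then obtain F where F: "F \<in> cauchy_seqs A" "P = cls F" by (rule carrierE)
  have "(-1) \<odot>\<^bsub>A\<^esub> F i \<oplus>\<^bsub>A\<^esub> F i = \<zero>\<^bsub>A\<^esub>" for i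
    using F by (simp add: M.M.l_neg cauchy_seqs_closed flip: module_minus_eq_smult[OF module])
  then have "cls (\<lambda>i. (-1) \<odot>\<^bsub>A\<^esub> F i) \<oplus>\<^bsub>completion A\<^esub> P = \<zero>\<^bsub>completion A\<^esub>"
    using F by (simp add: completion_add cauchy_seqs_smult completion_zero)
  then show "\<exists>Q\<in>carrier (completion A). Q \<oplus>\<^bsub>completion A\<^esub> P = \<zero>\<^bsub>completion A\<^esub>"
    using F cls_closed cauchy_seqs_smult by blast
qed (auto elim!: carrierE simp: completion_add completion_zero cls_closed cauchy_seqs_add
    cauchy_seqs_const cauchy_seqs_closed M.M.a_ac)

lemma completion_module: "module ring_of_type_algebra (completion A)"
  by (rule moduleI) (auto elim!: carrierE simp: completion_abelian_group cring_from_type_algebra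
    completion_add completion_smult cls_closed cauchy_seqs_add cauchy_seqs_smult cauchy_seqs_closed
    M.smult_l_distr[simplified] M.smult_r_distr[simplified] M.smult_assoc1[simplified] M.smult_one[simplified])

lemma completion_nrm_eq_0:
  assumes "F \<in> cauchy_seqs A"
  shows "nrm (completion A) (cls F) = 0 \<longleftrightarrow> (\<lambda>i. nrm A (F i)) \<longlonglongrightarrow> 0"
  using completion_nrm[OF assms] LIMSEQ_unique by auto

lemma cls_eq_zero_iff:
  "F \<in> cauchy_seqs A \<Longrightarrow> cls F = \<zero>\<^bsub>completion A\<^esub> \<longleftrightarrow> (\<lambda>i. nrm A (F i)) \<longlonglongrightarrow> 0"
  by (simp add: completion_zero cls_eq_iff cauchy_seqs_const dist_zero cauchy_seqs_closed)

lemma completion_normed_space: "normed_space (completion A)"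
  unfolding normed_space_def
proof (intro conjI ballI allI)
  show "module ring_of_type_algebra (completion A)" by (rule completion_module)
next
  fix P assume "P \<in> carrier (completion A)"
  then obtain F where F: "F \<in> cauchy_seqs A" "P = cls F" by (rule carrierE)
  show "0 \<le> nrm (completion A) P"
    using F nrm_nonneg cauchy_seqs_closed by (auto intro!: LIMSEQ_le_const[OF completion_nrm])
  show "nrm (completion A) P = 0 \<longleftrightarrow> P = \<zero>\<^bsub>completion A\<^esub>"
    using F by (simp add: completion_nrm_eq_0 cls_eq_zero_iff)
  fix c
  have "(\<lambda>i. nrm A (c \<odot>\<^bsub>A\<^esub> F i)) \<longlonglongrightarrow> cmod c * nrm (completion A) (cls F)"
    using tendsto_mult_left[OF completion_nrm[OF F(1)]] F by (simp add: nrm_smult cauchy_seqs_closed)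
  then show "nrm (completion A) (c \<odot>\<^bsub>completion A\<^esub> P) = cmod c * nrm (completion A) P"
    using completion_nrm[OF cauchy_seqs_smult[OF F(1), of c]] LIMSEQ_unique F by (simp add: completion_smult)
next
  fix P Q assume "P \<in> carrier (completion A)" "Q \<in> carrier (completion A)"
  then obtain F G where FG: "F \<in> cauchy_seqs A" "P = cls F" "G \<in> cauchy_seqs A" "Q = cls G"
    by (auto elim!: carrierE)
  show "nrm (completion A) (P \<oplus>\<^bsub>completion A\<^esub> Q) \<le> nrm (completion A) P + nrm (completion A) Q"
    using LIMSEQ_le[OF completion_nrm[OF cauchy_seqs_add[OF FG(1,3)]]
        tendsto_add[OF completion_nrm[OF FG(1)] completion_nrm[OF FG(3)]]] FG
    by (simp add: nrm_triangle cauchy_seqs_closed completion_add)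
qed

lemma completion_dist:
  assumes "F \<in> cauchy_seqs A" "G \<in> cauchy_seqs A"
  shows "(\<lambda>i. dist_A (F i) (G i)) \<longlonglongrightarrow> nrm_dist (completion A) (cls F) (cls G)"
proof -
  have "cls F \<ominus>\<^bsub>completion A\<^esub> cls G = cls (\<lambda>i. F i \<ominus>\<^bsub>A\<^esub> G i)"
    using assms abelian_group.minus_eq[OF completion_abelian_group]
    by (simp add: a_minus_def module_minus_eq_smult[OF completion_module] completion_smult cls_closed
        completion_add cauchy_seqs_smult module_minus_eq_smult[OF module] cauchy_seqs_closed)
  moreover have "(\<lambda>i. F i \<ominus>\<^bsub>A\<^esub> G i) \<in> cauchy_seqs A"
    using cauchy_seqs_add[OF assms(1) cauchy_seqs_smult[OF assms(2), of "-1"]] assms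
    by (simp add: a_minus_def module_minus_eq_smult[OF module] cauchy_seqs_closed)
  ultimately show ?thesis
    using completion_nrm assms by (fastforce simp: nrm_dist_def cls_closed cauchy_seqs_closed)
qed

text \<open>A late enough term of a representing sequence, regarded as a constant sequence,
  approximates the class.\<close>

lemma completion_dense:
  assumes "P \<in> carrier (completion A)" "e > 0"
  obtains x where "x \<in> carrier A" "nrm_dist (completion A) P (cls (\<lambda>i. x)) < e"
proof -
  obtain F where F: "F \<in> cauchy_seqs A" "P = cls F" using assms(1) by (rule carrierE)
  have "eventually (\<lambda>p. dist_A (F (fst p)) (F (snd p)) < e / 2) (sequentially \<times>\<^sub>F sequentially)"
    using order_tendstoD(2)[OF cauchy_seqsD[OF F(1)], of "e / 2"] assms(2) by auto
  then obtain N where N: "\<And>m n. m \<ge> N \<Longrightarrow> n \<ge> N \<Longrightarrow> dist_A (F m) (F n) < e / 2"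
    unfolding eventually_prod_sequentially by auto
  \<comment> \<open>A limit of numbers below e / 2 is only known to be at most e / 2; starting from
    e / 2 keeps the final estimate strict.\<close>
  have "nrm_dist (completion A) P (cls (\<lambda>i. F N)) \<le> e / 2"
    unfolding F(2) 
    by (rule LIMSEQ_le_const2[OF completion_dist[OF F(1) cauchy_seqs_const]])
      (use F N in \<open>auto simp: cauchy_seqs_closed intro!: exI[of _ N] less_imp_le\<close>)
  with assms(2) F that[of "F N"] show thesis by (simp add: cauchy_seqs_closed)
qed

text \<open>A diagonal choice: pick \<open>x k\<close> in A within 1 / (k + 1) of \<sigma>(k). Then
  x is a Cauchy sequence of A, and its class is the limit of \<sigma>.\<close>

lemma completion_mcomplete:
  "Metric_space.mcomplete (carrier (completion A)) (nrm_dist (completion A))"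
proof -
  interpret C: normed_module "completion A" by unfold_locales (rule completion_normed_space)
  show ?thesis unfolding C.metric.mcomplete_def
  proof (intro allI impI)
    fix \<sigma> assume "C.metric.MCauchy \<sigma>"
    then have \<sigma>: "\<sigma> \<in> cauchy_seqs (completion A)" by (simp add: cauchy_seqs_def)
    note \<sigma>_in = C.cauchy_seqs_closed[OF \<sigma>]
    define \<delta> where "\<delta> k = inverse (real (Suc k))" for k
    have "\<exists>y. y \<in> carrier A \<and> C.dist_A (\<sigma> k) (cls (\<lambda>i. y)) < \<delta> k" for k
    proof -
      have "\<delta> k > 0" by (simp add: \<delta>_def)
      from completion_dense[OF \<sigma>_in this] show ?thesis by blast
    qed
    then have "\<exists>x. \<forall>k. x k \<in> carrier A \<and> C.dist_A (\<sigma> k) (cls (\<lambda>i. x k)) < \<delta> k"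
      by (intro choice allI)
    then obtain x where x: "\<And>k. x k \<in> carrier A" "\<And>k. C.dist_A (\<sigma> k) (cls (\<lambda>i. x k)) < \<delta> k"
      by blast
    have \<delta>0: "\<delta> \<longlonglongrightarrow> 0" unfolding \<delta>_def by (rule LIMSEQ_inverse_real_of_nat)
    have const: "cls (\<lambda>i. x k) \<in> carrier (completion A)" for k by (simp add: cls_closed cauchy_seqs_const x)
    have dist_const: "C.dist_A (cls (\<lambda>i. x m)) (cls (\<lambda>i. x n)) = dist_A (x m) (x n)" for m n
      using completion_dist[of "\<lambda>i. x m" "\<lambda>i. x n"] by (simp add: cauchy_seqs_const x LIMSEQ_const_iff)
    \<comment> \<open>Two triangle inequalities in the completion through \<sigma>(m) and
      \<sigma>(n); the embedding of A as constant sequences is isometric.\<close>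
    have bound: "dist_A (x m) (x n) \<le> \<delta> m + C.dist_A (\<sigma> m) (\<sigma> n) + \<delta> n" for m n
      using C.dist_triangle[OF const[of m] \<sigma>_in[of m] const[of n]]
        C.dist_triangle[OF \<sigma>_in[of m] \<sigma>_in[of n] const[of n]]
        x(2)[of m] x(2)[of n] by (simp add: dist_const C.dist_commute[of "cls _" "\<sigma> _"])
    have "((\<lambda>p. \<delta> (fst p) + C.dist_A (\<sigma> (fst p)) (\<sigma> (snd p)) + \<delta> (snd p)) \<longlongrightarrow> 0) (sequentially \<times>\<^sub>F sequentially)"
      using tendsto_add[OF tendsto_add[OF filterlim_compose[OF \<delta>0 filterlim_fst] C.cauchy_seqsD[OF \<sigma>]]
        filterlim_compose[OF \<delta>0 filterlim_snd]] by simp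
    then have "((\<lambda>p. dist_A (x (fst p)) (x (snd p))) \<longlongrightarrow> 0) (sequentially \<times>\<^sub>F sequentially)"
      by (rule tendsto_0_le[where K = 1]) 
        (auto intro!: always_eventually order_trans[OF bound] simp: dist_nonneg)
    then have xc: "x \<in> cauchy_seqs A" by (simp add: cauchy_seqs_iff x)
    have "(\<lambda>k. C.dist_A (\<sigma> k) (cls x)) \<longlonglongrightarrow> 0"
    proof (rule LIMSEQ_I)
      fix e :: real assume "e > 0"
      then have "eventually (\<lambda>p. dist_A (x (fst p)) (x (snd p)) < e / 3) (sequentially \<times>\<^sub>F sequentially)"
        using order_tendstoD(2)[OF cauchy_seqsD[OF xc], of "e / 3"] by auto
      then obtain N where N: "\<And>m n. m \<ge> N \<Longrightarrow> n \<ge> N \<Longrightarrow> dist_A (x m) (x n) < e / 3"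
        unfolding eventually_prod_sequentially by auto
      obtain K where K: "\<And>k. k \<ge> K \<Longrightarrow> \<delta> k < e / 3"
        using order_tendstoD(2)[OF \<delta>0, of "e / 3"] \<open>e > 0\<close> by (auto simp: eventually_sequentially)
      have "C.dist_A (\<sigma> k) (cls x) < e" if "k \<ge> max N K" for k
      proof -
        have "C.dist_A (cls (\<lambda>i. x k)) (cls x) \<le> e / 3"
          by (rule LIMSEQ_le_const2[OF completion_dist[OF cauchy_seqs_const[OF x(1)] xc]])
            (use N that in \<open>auto intro!: exI[of _ N] less_imp_le\<close>)
        with C.dist_triangle[OF \<sigma>_in[of k] const[of k] cls_closed[OF xc]] x(2)[of k] K[of k] that \<open>e > 0\<close>
        show ?thesis by simp
      qed
      then show "\<exists>no. \<forall>n\<ge>no. norm (C.dist_A (\<sigma> n) (cls x) - 0) < e"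
        by (intro exI[of _ "max N K"]) (simp add: C.dist_nonneg)
    qed
    then have "limitin C.metric.mtopology \<sigma> (cls x) sequentially"
      by (simp add: C.metric.limitin_metric_dist_null cls_closed[OF xc] \<sigma>_in)
    then show "\<exists>x. limitin C.metric.mtopology \<sigma> x sequentially" ..
  qed
qed

end

section \<open>Multiplication in the completion\<close>

locale normed_algebra = normed_module A + algebra ring_of_type_algebra A 
  for A :: "'a normed_module" +
  fixes K :: real
  assumes submult: "x \<in> carrier A \<Longrightarrow> y \<in> carrier A \<Longrightarrow> nrm A (x \<otimes>\<^bsub>A\<^esub> y) \<le> K * nrm A x * nrm A y"
    and K_pos: "K > 0"
begin

lemma mult_closed [simp]: "x \<in> carrier A \<Longrightarrow> y \<in> carrier A \<Longrightarrow> x \<otimes>\<^bsub>A\<^esub> y \<in> carrier A"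
  using M_cring by (simp add: cring.cring_simprules(5))

lemma dist_mult_le:
  assumes "x \<in> carrier A" "y \<in> carrier A" "x' \<in> carrier A" "y' \<in> carrier A"
  shows "dist_A (x \<otimes>\<^bsub>A\<^esub> y) (x' \<otimes>\<^bsub>A\<^esub> y') \<le> K * (dist_A x x' * nrm A y + nrm A x' * dist_A y y')"
proof -
  have "(x \<otimes>\<^bsub>A\<^esub> y) \<ominus>\<^bsub>A\<^esub> (x' \<otimes>\<^bsub>A\<^esub> y') = (x \<ominus>\<^bsub>A\<^esub> x') \<otimes>\<^bsub>A\<^esub> y \<oplus>\<^bsub>A\<^esub> x' \<otimes>\<^bsub>A\<^esub> (y \<ominus>\<^bsub>A\<^esub> y')"
    using assms by algebra
  then have "dist_A (x \<otimes>\<^bsub>A\<^esub> y) (x' \<otimes>\<^bsub>A\<^esub> y')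
      \<le> nrm A ((x \<ominus>\<^bsub>A\<^esub> x') \<otimes>\<^bsub>A\<^esub> y) + nrm A (x' \<otimes>\<^bsub>A\<^esub> (y \<ominus>\<^bsub>A\<^esub> y'))"
    using assms by (simp add: dist_eq nrm_triangle)
  also have "\<dots> \<le> K * nrm A (x \<ominus>\<^bsub>A\<^esub> x') * nrm A y + K * nrm A x' * nrm A (y \<ominus>\<^bsub>A\<^esub> y')"
    using assms by (intro add_mono submult) auto
  finally show ?thesis using assms by (simp add: dist_eq algebra_simps)
qed

lemma cauchy_seqs_mult:
  assumes "F \<in> cauchy_seqs A" "G \<in> cauchy_seqs A"
  shows "(\<lambda>i. F i \<otimes>\<^bsub>A\<^esub> G i) \<in> cauchy_seqs A"
proof -
  \<comment> \<open>The norms of the terms converge to the norms of the classes, so the factors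
    tending to 0 carry the whole bound to 0.\<close>
  have lim: "((\<lambda>p. K * (dist_A (F (fst p)) (F (snd p)) * nrm A (G (fst p)) + nrm A (F (snd p)) * dist_A (G (fst p)) (G (snd p)))) \<longlongrightarrow>
      K * (0 * nrm (completion A) (cls G) + nrm (completion A) (cls F) * 0)) (sequentially \<times>\<^sub>F sequentially)"
        by (intro tendsto_intros filterlim_compose[OF completion_nrm[OF assms(1)] filterlim_snd]
      filterlim_compose[OF completion_nrm[OF assms(2)] filterlim_fst]
      cauchy_seqsD[OF assms(1)] cauchy_seqsD[OF assms(2)])
  have "((\<lambda>p. dist_A (F (fst p) \<otimes>\<^bsub>A\<^esub> G (fst p)) (F (snd p) \<otimes>\<^bsub>A\<^esub> G (snd p))) \<longlongrightarrow> 0) (sequentially \<times>\<^sub>F sequentially)"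
    by (rule tendsto_0_le[OF lim[simplified], where K = 1])
      (use assms in \<open>auto simp: dist_nonneg cauchy_seqs_closed intro!: always_eventually order_trans[OF dist_mult_le]\<close>)
  then show ?thesis using assms by (simp add: cauchy_seqs_iff)
qed

lemma completion_mult:
  assumes "F \<in> cauchy_seqs A" "G \<in> cauchy_seqs A"
  shows "cls F \<otimes>\<^bsub>completion A\<^esub> cls G = cls (\<lambda>i. F i \<otimes>\<^bsub>A\<^esub> G i)"
proof -
  have "(\<lambda>F G. cls (\<lambda>i. F i \<otimes>\<^bsub>A\<^esub> G i)) respects2 null_diff A"
  proof (rule congruent2I')
    fix F F' G G' assume *: "(F, F') \<in> null_diff A" "(G, G') \<in> null_diff A"
    then have mem: "F \<in> cauchy_seqs A" "F' \<in> cauchy_seqs A" "G \<in> cauchy_seqs A" "G' \<in> cauchy_seqs A"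
      by (simp_all add: null_diff_iff)
    have lim: "(\<lambda>i. K * (dist_A (F i) (F' i) * nrm A (G i) + nrm A (F' i) * dist_A (G i) (G' i)))
        \<longlonglongrightarrow> K * (0 * nrm (completion A) (cls G) + nrm (completion A) (cls F') * 0)"
      using * by (intro tendsto_intros completion_nrm mem) (simp_all add: null_diff_iff)
    have "(\<lambda>i. dist_A (F i \<otimes>\<^bsub>A\<^esub> G i) (F' i \<otimes>\<^bsub>A\<^esub> G' i)) \<longlonglongrightarrow> 0"
      by (rule tendsto_0_le[OF lim[simplified], where K = 1])
        (use mem in \<open>auto simp: dist_nonneg cauchy_seqs_closed intro!: always_eventually order_trans[OF dist_mult_le]\<close>)
    with mem show "cls (\<lambda>i. F i \<otimes>\<^bsub>A\<^esub> G i) = cls (\<lambda>i. F' i \<otimes>\<^bsub>A\<^esub> G' i)"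
      by (simp add: cls_eq_iff cauchy_seqs_mult)
  qed
  from UN_equiv_class2[OF equiv_null_diff equiv_null_diff this assms] show ?thesis
    by (simp add: completion_def cls_def)
qed

text \<open>The inequality passes to the limit with the same \<open>K\<close>. This is why
  \<open>K\<close> is a parameter of the locale: an explicit constant on the dense subspace is
  inherited by the completion.\<close>

lemma completion_submult:
  assumes "P \<in> carrier (completion A)" "Q \<in> carrier (completion A)"
  shows "nrm (completion A) (P \<otimes>\<^bsub>completion A\<^esub> Q) \<le> K * nrm (completion A) P * nrm (completion A) Q"
proof -
  obtain F G where FG: "F \<in> cauchy_seqs A" "P = cls F" "G \<in> cauchy_seqs A" "Q = cls G"
    using assms by (auto elim!: carrierE)
  show ?thesis unfolding FG completion_mult[OF FG(1,3)]
    by (rule LIMSEQ_le[OF completion_nrm[OF cauchy_seqs_mult[OF FG(1,3)]]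
        tendsto_mult[OF tendsto_mult_left[OF completion_nrm[OF FG(1)]] completion_nrm[OF FG(3)]]])
      (use FG in \<open>auto intro!: submult simp: cauchy_seqs_closed\<close>)
qed

lemma completion_algebra: "algebra ring_of_type_algebra (completion A)"
proof -
  have "comm_monoid (completion A)"
    by (rule comm_monoidI) (auto elim!: carrierE simp: completion_mult completion_one cls_closed 
      cauchy_seqs_mult cauchy_seqs_const cauchy_seqs_closed cring.cring_simprules[OF M_cring])
  then have cring: "cring (completion A)"
    by (rule cringI[OF completion_abelian_group]) (auto elim!: carrierE simp: completion_mult 
      completion_add cauchy_seqs_add cauchy_seqs_mult cauchy_seqs_closed cring.cring_simprules[OF M_cring])
  interpret C: module ring_of_type_algebra "completion A" by (rule completion_module)
  show ?thesis
    by (rule algebraI[OF cring_from_type_algebra cring])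
      (auto simp: C.smult_l_distr[simplified] C.smult_r_distr[simplified] C.smult_assoc1[simplified]
        C.smult_one[simplified] C.smult_closed[simplified] elim!: carrierE 
        simp: completion_mult completion_smult cauchy_seqs_mult cauchy_seqs_smult cauchy_seqs_closed
        smult_assoc2[simplified])
qed

lemma completion_banach_algebra: "banach_algebra (completion A)"
  unfolding banach_algebra_def using completion_algebra completion_normed_space completion_mcomplete
    completion_submult K_pos by blast

end

section \<open>Extension of bounded linear maps to completions\<close>

locale bounded_map = A: normed_module A + B: normed_module B
  for A :: "'a normed_module" and B :: "'b normed_module" +
  fixes T
  assumes bounded: "bounded_linear_map A B T"
begin

lemma map_closed: "x \<in> carrier A \<Longrightarrow> T x \<in> carrier B"
  and map_add: "x \<in> carrier A \<Longrightarrow> y \<in> carrier A \<Longrightarrow> T (x \<oplus>\<^bsub>A\<^esub> y) = T x \<oplus>\<^bsub>B\<^esub> T y"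
  and map_smult: "x \<in> carrier A \<Longrightarrow> T (c \<odot>\<^bsub>A\<^esub> x) = c \<odot>\<^bsub>B\<^esub> T x"
  using bounded by (auto simp: bounded_linear_map_def)

lemma map_diff: "x \<in> carrier A \<Longrightarrow> y \<in> carrier A \<Longrightarrow> T (x \<ominus>\<^bsub>A\<^esub> y) = T x \<ominus>\<^bsub>B\<^esub> T y"
  by (simp add: a_minus_def module_minus_eq_smult[OF A.module] module_minus_eq_smult[OF B.module]
      map_closed map_add map_smult)

text \<open>The constant in \<open>bounded_linear_map\<close> may have any sign; its absolute value
  is still a bound because norms are nonnegative.\<close>

lemma nrm_map_le:
  obtains C where "C \<ge> 0" "\<And>x. x \<in> carrier A \<Longrightarrow> nrm B (T x) \<le> C * nrm A x"
proof -
  obtain C where C: "\<And>x. x \<in> carrier A \<Longrightarrow> nrm B (T x) \<le> C * nrm A x"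
    using bounded unfolding bounded_linear_map_def by blast
  have "nrm B (T x) \<le> \<bar>C\<bar> * nrm A x" if "x \<in> carrier A" for x
    using C[OF that] mult_right_mono[OF abs_ge_self A.nrm_nonneg[OF that], of C] by linarith
  then show thesis using that[of "\<bar>C\<bar>"] by simp
qed

lemma dist_map_le:
  obtains C where "C \<ge> 0"
    "\<And>x y. x \<in> carrier A \<Longrightarrow> y \<in> carrier A \<Longrightarrow> nrm_dist B (T x) (T y) \<le> C * nrm_dist A x y"
proof -
  obtain C where "C \<ge> 0" "\<And>x. x \<in> carrier A \<Longrightarrow> nrm B (T x) \<le> C * nrm A x"
    by (rule nrm_map_le) blast
  then show thesis using that[of C] by (simp add: A.dist_eq B.dist_eq map_closed flip: map_diff)
qed

lemma map_cauchy_seqs: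
  assumes "F \<in> cauchy_seqs A" shows "(\<lambda>i. T (F i)) \<in> cauchy_seqs B"
proof -
  obtain C where C: "C \<ge> 0"
    "\<And>x y. x \<in> carrier A \<Longrightarrow> y \<in> carrier A \<Longrightarrow> nrm_dist B (T x) (T y) \<le> C * nrm_dist A x y"
    by (rule dist_map_le) blast
  have "((\<lambda>p. nrm_dist B (T (F (fst p))) (T (F (snd p)))) \<longlongrightarrow> 0) (sequentially \<times>\<^sub>F sequentially)"
    by (rule tendsto_0_le[OF A.cauchy_seqsD[OF assms], where K = C])
      (use assms C in \<open>auto simp: A.dist_nonneg B.dist_nonneg A.cauchy_seqs_closed mult.commute intro!: always_eventually\<close>)
  then show ?thesis using assms by (simp add: B.cauchy_seqs_iff map_closed A.cauchy_seqs_closed)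
qed

lemma map_null_diff:
  assumes "(F, G) \<in> null_diff A" shows "(\<lambda>i. T (F i), \<lambda>i. T (G i)) \<in> null_diff B"
proof -
  obtain C where C: "C \<ge> 0"
    "\<And>x y. x \<in> carrier A \<Longrightarrow> y \<in> carrier A \<Longrightarrow> nrm_dist B (T x) (T y) \<le> C * nrm_dist A x y"
    by (rule dist_map_le) blast
  have FG: "F \<in> cauchy_seqs A" "G \<in> cauchy_seqs A" "(\<lambda>i. nrm_dist A (F i) (G i)) \<longlonglongrightarrow> 0"
    using assms by (simp_all add: A.null_diff_iff)
  have "(\<lambda>i. nrm_dist B (T (F i)) (T (G i))) \<longlonglongrightarrow> 0"
    by (rule tendsto_0_le[OF FG(3), where K = C])
      (use FG C in \<open>auto simp: A.dist_nonneg B.dist_nonneg A.cauchy_seqs_closed mult.commute\<close>)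
  with FG show ?thesis by (simp add: B.null_diff_iff map_cauchy_seqs)
qed

definition completion_map :: "(nat \<Rightarrow> 'a) set \<Rightarrow> (nat \<Rightarrow> 'b) set" where
  "completion_map P = (\<Union>F\<in>P. B.cls (\<lambda>i. T (F i)))"

lemma completion_map_cls:
  assumes "F \<in> cauchy_seqs A" shows "completion_map (A.cls F) = B.cls (\<lambda>i. T (F i))"
proof -
  have "(\<lambda>F. B.cls (\<lambda>i. T (F i))) respects null_diff A"
    by (rule congruentI) (use map_null_diff equiv_class_eq[OF B.equiv_null_diff] in \<open>simp add: B.cls_def\<close>)
  from UN_equiv_class[OF A.equiv_null_diff this assms] show ?thesis
    by (simp add: completion_map_def A.cls_def)
qed

lemma completion_map_embed:
  "x \<in> carrier A \<Longrightarrow> completion_map (completion_embed A x) = completion_embed B (T x)"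
  by (simp add: A.completion_embed B.completion_embed completion_map_cls A.cauchy_seqs_const)

lemma completion_map_bounded: "bounded_linear_map (completion A) (completion B) completion_map"
proof -
  obtain C where C: "C \<ge> 0" "\<And>x. x \<in> carrier A \<Longrightarrow> nrm B (T x) \<le> C * nrm A x"
    by (rule nrm_map_le) blast
  have "nrm (completion B) (completion_map P) \<le> C * nrm (completion A) P"
    if P: "P \<in> carrier (completion A)" for P
  proof -
    obtain F where F: "F \<in> cauchy_seqs A" "P = A.cls F" using A.carrierE[OF P] by blast
    show ?thesis unfolding F completion_map_cls[OF F(1)]
      by (rule LIMSEQ_le[OF B.completion_nrm[OF map_cauchy_seqs[OF F(1)]]
          tendsto_mult_left[OF A.completion_nrm[OF F(1)]]])
        (use F C in \<open>auto simp: A.cauchy_seqs_closed\<close>)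
  qed
  then have "\<exists>C. \<forall>P\<in>carrier (completion A). nrm (completion B) (completion_map P) \<le> C * nrm (completion A) P"
    by blast
  then show ?thesis unfolding bounded_linear_map_def
    by (intro conjI) (auto elim!: A.carrierE simp: completion_map_cls A.completion_add B.completion_add
      A.completion_smult B.completion_smult A.cauchy_seqs_add A.cauchy_seqs_smult map_cauchy_seqs
      B.cls_closed map_add map_smult A.cauchy_seqs_closed)
qed

end

text \<open>Triviality of the kernel, stated through norms because these are what limits along
  representatives determine in a completion.\<close>

lemma bounded_linear_map_inj_on:
  assumes "normed_space A" "normed_space B" "bounded_linear_map A B T"
    and ker: "\<And>x. x \<in> carrier A \<Longrightarrow> nrm B (T x) = 0 \<Longrightarrow> nrm A x = 0"
  shows "inj_on T (carrier A)"
proof (rule inj_onI)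
  interpret bounded_map A B T using assms by unfold_locales
  fix x y assume xy: "x \<in> carrier A" "y \<in> carrier A" "T x = T y"
  then have "nrm B (T (x \<ominus>\<^bsub>A\<^esub> y)) = 0"
    by (simp add: map_diff map_closed B.M.M.minus_eq B.M.M.r_neg B.nrm_eq_0)
  then show "x = y" using ker[of "x \<ominus>\<^bsub>A\<^esub> y"] xy A.dist_eq_0 A.dist_eq by simp
qed

section \<open>Maps into spaces that are already complete\<close>

lemma (in normed_module) nrm_completion_const:
  "x \<in> carrier A \<Longrightarrow> nrm (completion A) (cls (\<lambda>i. x)) = nrm A x"
  using completion_nrm[OF cauchy_seqs_const] by (simp add: LIMSEQ_const_iff)

lemma (in normed_module) cls_const_inject:
  "x \<in> carrier A \<Longrightarrow> y \<in> carrier A \<Longrightarrow> cls (\<lambda>i. x) = cls (\<lambda>i. y) \<longleftrightarrow> x = y"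
  by (simp add: cls_eq_iff cauchy_seqs_const LIMSEQ_const_iff dist_eq_0)

text \<open>A Cauchy sequence differs from the constant sequence at its limit by a null sequence, so
  completing a complete space adds no new points.\<close>

lemma (in normed_module) complete_cls_const:
  assumes "metric.mcomplete" "P \<in> carrier (completion A)"
  shows "\<exists>!x. x \<in> carrier A \<and> P = cls (\<lambda>i. x)"
proof -
  obtain F where F: "F \<in> cauchy_seqs A" "P = cls F" using assms(2) by (rule carrierE)
  then have "metric.MCauchy F" by (simp add: cauchy_seqs_def)
  then obtain x where "limitin metric.mtopology F x sequentially"
    using assms(1) unfolding metric.mcomplete_def by blast
  then have "x \<in> carrier A" "(\<lambda>i. dist_A (F i) x) \<longlonglongrightarrow> 0"
    by (simp_all add: metric.limitin_metric_dist_null)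
  then have "x \<in> carrier A \<and> P = cls (\<lambda>i. x)" using F by (simp add: cls_eq_iff cauchy_seqs_const)
  then show ?thesis using cls_const_inject by auto
qed

text \<open>The extension into \<open>completion B\<close> is pulled back along the isometric
  bijection from B onto \<open>completion B\<close>. The equation between norms is recorded so that
  the kernel of \<open>J\<close> can be computed with representatives.\<close>

lemma (in bounded_map) extension_to_complete:
  assumes "B.metric.mcomplete"
  obtains J where "bounded_linear_map (completion A) B J"
    "\<And>x. x \<in> carrier A \<Longrightarrow> J (completion_embed A x) = T x"
    "\<And>P. P \<in> carrier (completion A) \<Longrightarrow> nrm B (J P) = nrm (completion B) (completion_map P)"
proof -
  have bdd: "completion_map P \<in> carrier (completion B)"
      "Q \<in> carrier (completion A) \<Longrightarrow> 
        completion_map (P \<oplus>\<^bsub>completion A\<^esub> Q) = completion_map P \<oplus>\<^bsub>completion B\<^esub> completion_map Q"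
      "completion_map (c \<odot>\<^bsub>completion A\<^esub> P) = c \<odot>\<^bsub>completion B\<^esub> completion_map P"
    if "P \<in> carrier (completion A)" for P Q c
    using completion_map_bounded that by (auto simp: bounded_linear_map_def)
  interpret CA: normed_module "completion A" by unfold_locales (rule A.completion_normed_space)
  define J where "J P = (THE y. y \<in> carrier B \<and> completion_map P = B.cls (\<lambda>i. y))" for P
  have J: "J P \<in> carrier B" "completion_map P = B.cls (\<lambda>i. J P)" if "P \<in> carrier (completion A)" for P
    using theI'[OF B.complete_cls_const[OF assms bdd(1)[OF that]]] unfolding J_def by blast+
  have J_eq: "J P = y" if "P \<in> carrier (completion A)" "y \<in> carrier B" "completion_map P = B.cls (\<lambda>i. y)" for P y
    using that J[OF that(1)] B.cls_const_inject[of y "J P"] by simp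
  have nrm: "nrm B (J P) = nrm (completion B) (completion_map P)" if "P \<in> carrier (completion A)" for P
    using J[OF that] by (simp add: B.nrm_completion_const)
  show thesis
  proof (rule that)
    show "nrm B (J P) = nrm (completion B) (completion_map P)" if "P \<in> carrier (completion A)" for P
      using nrm[OF that] .
    show "J (completion_embed A x) = T x" if "x \<in> carrier A" for x
      using that completion_map_embed[OF that] 
      by (intro J_eq) (simp_all add: A.completion_embed B.completion_embed A.cls_closed A.cauchy_seqs_const map_closed)
    have add: "J (P \<oplus>\<^bsub>completion A\<^esub> Q) = J P \<oplus>\<^bsub>B\<^esub> J Q"
      if "P \<in> carrier (completion A)" "Q \<in> carrier (completion A)" for P Q
      using that J[OF that(1)] J[OF that(2)]
      by (intro J_eq) (simp_all add: bdd(2) B.completion_add B.cauchy_seqs_const)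
    have smult: "J (c \<odot>\<^bsub>completion A\<^esub> P) = c \<odot>\<^bsub>B\<^esub> J P" if "P \<in> carrier (completion A)" for P c
      using that J[OF that] by (intro J_eq) (simp_all add: bdd(3) B.completion_smult B.cauchy_seqs_const)
    have "\<exists>C. \<forall>P\<in>carrier (completion A). nrm B (J P) \<le> C * nrm (completion A) P"
      using completion_map_bounded nrm by (simp add: bounded_linear_map_def)
    then show "bounded_linear_map (completion A) B J"
      unfolding bounded_linear_map_def using J(1) add smult by blast
  qed
qed

section \<open>Sequence algebras\<close>

lemma seq_algebra_simps [simp]:
  "carrier (seq_algebra S N) = S" "f \<otimes>\<^bsub>seq_algebra S N\<^esub> g = conv f g"
  "\<one>\<^bsub>seq_algebra S N\<^esub> = (\<lambda>n. if n = 0 then 1 else 0)" "\<zero>\<^bsub>seq_algebra S N\<^esub> = (\<lambda>n. 0)"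
  "f \<oplus>\<^bsub>seq_algebra S N\<^esub> g = (\<lambda>n. f n + g n)" "c \<odot>\<^bsub>seq_algebra S N\<^esub> f = (\<lambda>n. c * f n)"
  "nrm (seq_algebra S N) = N"
  by (simp_all add: seq_algebra_def)

lemma seq_algebra_module:
  assumes "(\<lambda>n. 0) \<in> S" "\<And>f g. f \<in> S \<Longrightarrow> g \<in> S \<Longrightarrow> (\<lambda>n. f n + g n) \<in> S"
    and smult: "\<And>c f. f \<in> S \<Longrightarrow> (\<lambda>n. c * f n) \<in> S"
  shows "module ring_of_type_algebra (seq_algebra S N)"
proof -
  have "abelian_group (seq_algebra S N)"
  proof (rule abelian_groupI)
    fix f assume "f \<in> carrier (seq_algebra S N)"
    then show "\<exists>g\<in>carrier (seq_algebra S N). g \<oplus>\<^bsub>seq_algebra S N\<^esub> f = \<zero>\<^bsub>seq_algebra S N\<^esub>"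
      using smult[of f "-1"] by (intro bexI[of _ "\<lambda>n. - f n"]) auto
  qed (use assms in \<open>auto simp: algebra_simps\<close>)
  then show ?thesis
    by (rule moduleI[OF cring_from_type_algebra]) (auto simp: smult algebra_simps)
qed

lemma seq_algebra_minus:
  assumes "module ring_of_type_algebra (seq_algebra S N)" "f \<in> S" "g \<in> S"
  shows "f \<ominus>\<^bsub>seq_algebra S N\<^esub> g = (\<lambda>n. f n - g n)"
  using assms by (simp add: a_minus_def module_minus_eq_smult)

lemma c00_module: "module ring_of_type_algebra (seq_algebra c00 N)"
  by (intro seq_algebra_module add_c00 smult_c00 zero_c00)

lemma c00_algebra: "algebra ring_of_type_algebra (seq_algebra c00 N)"
proof -
  interpret M: module ring_of_type_algebra "seq_algebra c00 N" by (rule c00_module)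
  have "comm_monoid (seq_algebra c00 N)"
    by (rule comm_monoidI) (auto simp: conv_c00 one_c00 conv_assoc conv_one intro: conv_commute)
  then have "cring (seq_algebra c00 N)"
    by (intro cringI M.M.abelian_group_axioms) (simp_all add: conv_add)
  then show ?thesis
    by (rule algebraI[OF cring_from_type_algebra]) (auto simp: smult_c00 conv_smult algebra_simps)
qed

lemma weyl_normed_space:
  assumes "\<alpha> \<ge> 0" "\<And>n. 0 < \<phi> n"
  shows "normed_space (seq_algebra c00 (weyl_norm \<alpha> \<phi>))"
proof -
  have "\<phi> n \<ge> 0" for n using assms(2)[of n] by simp
  then show ?thesis
    unfolding normed_space_def using weyl_norm_eq_0[OF assms]
    by (auto simp: c00_module assms weyl_norm_nonneg weyl_norm_zero weyl_norm_smult weyl_norm_add)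
qed

section \<open>The space of absolutely summable sequences\<close>

lemma l1_normed_space: "normed_space l1"
  unfolding normed_space_def l1_def
proof (intro conjI ballI allI)
  have add: "summable (\<lambda>n. cmod (f n + g n))" if "summable (\<lambda>n. cmod (f n))" "summable (\<lambda>n. cmod (g n))" for f g
    by (rule summable_comparison_test'[OF summable_add[OF that]]) (simp add: norm_triangle_ineq)
  show "module ring_of_type_algebra (seq_algebra {f. summable (\<lambda>n. cmod (f n))} l1_norm)"
    by (rule seq_algebra_module) (auto simp: norm_mult add intro: summable_mult)
  fix f g :: "nat \<Rightarrow> complex" and c
  assume f: "f \<in> carrier (seq_algebra {f. summable (\<lambda>n. cmod (f n))} l1_norm)"
  then show "0 \<le> nrm (seq_algebra {f. summable (\<lambda>n. cmod (f n))} l1_norm) f"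
    by (simp add: l1_norm_def suminf_nonneg)
  show "(nrm (seq_algebra {f. summable (\<lambda>n. cmod (f n))} l1_norm) f = 0) =
      (f = \<zero>\<^bsub>seq_algebra {f. summable (\<lambda>n. cmod (f n))} l1_norm\<^esub>)"
    using f suminf_eq_zero_iff[of "\<lambda>n. cmod (f n)"] by (auto simp: l1_norm_def fun_eq_iff)
  show "nrm (seq_algebra {f. summable (\<lambda>n. cmod (f n))} l1_norm)
      (c \<odot>\<^bsub>seq_algebra {f. summable (\<lambda>n. cmod (f n))} l1_norm\<^esub> f)
      = cmod c * nrm (seq_algebra {f. summable (\<lambda>n. cmod (f n))} l1_norm) f"
    using f by (simp add: l1_norm_def norm_mult suminf_mult)
  assume g: "g \<in> carrier (seq_algebra {f. summable (\<lambda>n. cmod (f n))} l1_norm)"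
  show "nrm (seq_algebra {f. summable (\<lambda>n. cmod (f n))} l1_norm)
      (f \<oplus>\<^bsub>seq_algebra {f. summable (\<lambda>n. cmod (f n))} l1_norm\<^esub> g)
      \<le> nrm (seq_algebra {f. summable (\<lambda>n. cmod (f n))} l1_norm) f
        + nrm (seq_algebra {f. summable (\<lambda>n. cmod (f n))} l1_norm) g"
    using f g by (simp add: l1_norm_def suminf_add suminf_le norm_triangle_ineq add summable_add)
qed

interpretation l1: normed_module l1
  by unfold_locales (rule l1_normed_space)

lemma l1_simps [simp]: "f \<in> carrier l1 \<longleftrightarrow> summable (\<lambda>n. cmod (f n))" "nrm l1 = l1_norm"
  by (simp_all add: l1_def)

lemma l1_dist:
  "f \<in> carrier l1 \<Longrightarrow> g \<in> carrier l1 \<Longrightarrow> nrm_dist l1 f g = l1_norm (\<lambda>n. f n - g n)"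
  using seq_algebra_minus[of _ l1_norm f g] l1.module by (simp add: l1.dist_eq) (simp add: l1_def)

text \<open>A Cauchy sequence in l1 converges pointwise to some f. Letting j tend to infinity in the
  norm of F i - F j, the Fatou-type lemma yields both the summability of F i - f and the bound on
  its norm.\<close>

lemma l1_mcomplete: "l1.metric.mcomplete"
  unfolding l1.metric.mcomplete_def
proof (intro allI impI)
  fix F assume F: "l1.metric.MCauchy F"
  then have Fin: "F i \<in> carrier l1" for i unfolding l1.metric.MCauchy_def by blast
  have diff: "summable (\<lambda>n. cmod (F i n - F j n))" for i j
    by (rule summable_comparison_test'[OF summable_add[OF Fin[of i, simplified] Fin[of j, simplified]]])
      (simp add: norm_triangle_ineq4)
  have Cauchy: "\<exists>N. \<forall>i j. N \<le> i \<longrightarrow> N \<le> j \<longrightarrow> (\<Sum>n. cmod (F i n - F j n)) < e" if "e > 0" for e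
    using F that by (simp add: l1.metric.MCauchy_def l1_dist[OF Fin Fin] l1_norm_def)
  have "convergent (\<lambda>i. F i n)" for n
  proof (rule Cauchy_convergent, rule CauchyI)
    fix e :: real assume "e > 0"
    then obtain N where N: "\<And>i j. N \<le> i \<Longrightarrow> N \<le> j \<Longrightarrow> (\<Sum>n. cmod (F i n - F j n)) < e" using Cauchy by blast
    have "cmod (F i n - F j n) < e" if "N \<le> i" "N \<le> j" for i j
      using N[OF that] sum_le_suminf[OF diff[of i j], of "{n}"] by simp
    then show "\<exists>M. \<forall>i\<ge>M. \<forall>j\<ge>M. norm (F i n - F j n) < e" by blast
  qed
  then obtain f where f: "\<And>n. (\<lambda>i. F i n) \<longlonglongrightarrow> f n" unfolding convergent_def by metis
  have close: "\<exists>N. \<forall>i\<ge>N. summable (\<lambda>n. cmod (F i n - f n)) \<and> (\<Sum>n. cmod (F i n - f n)) < e" if e: "e > 0" for e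
  proof -
    obtain N where N: "\<And>i j. N \<le> i \<Longrightarrow> N \<le> j \<Longrightarrow> (\<Sum>n. cmod (F i n - F j n)) < e / 2"
      using Cauchy[of "e / 2"] e by auto
    have "summable (\<lambda>n. cmod (F i n - f n)) \<and> (\<Sum>n. cmod (F i n - f n)) < e" if i: "i \<ge> N" for i
    proof -
      have lim: "(\<lambda>j. cmod (F i n - F j n)) \<longlonglongrightarrow> cmod (F i n - f n)" for n by (intro tendsto_intros f)
      have ev: "eventually (\<lambda>j. (\<Sum>n. cmod (F i n - F j n)) \<le> e / 2) sequentially"
        unfolding eventually_sequentially using N[OF i] less_imp_le by blast
      from suminf_le_of_pointwise_limit[of "\<lambda>j n. cmod (F i n - F j n)", OF lim _ diff ev] e
      show ?thesis by simp
    qed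
    then show ?thesis by blast
  qed
  obtain N where N: "summable (\<lambda>n. cmod (F N n - f n))" using close[of 1] by auto
  have "summable (\<lambda>n. cmod (f n))"
    by (rule summable_comparison_test'[OF summable_add[OF Fin[of N, simplified] N]])
      (use norm_triangle_sub[of "f _" "F N _"] in \<open>simp add: norm_minus_commute\<close>)
  then have fin: "f \<in> carrier l1" by simp
  have "(\<lambda>i. nrm_dist l1 (F i) f) \<longlonglongrightarrow> 0"
  proof (rule LIMSEQ_I)
    fix e :: real assume "e > 0"
    from close[OF this] obtain N where
      "\<And>i. i \<ge> N \<Longrightarrow> summable (\<lambda>n. cmod (F i n - f n)) \<and> (\<Sum>n. cmod (F i n - f n)) < e" by blast
    then have "norm (nrm_dist l1 (F i) f - 0) < e" if "i \<ge> N" for i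
      using that by (simp add: l1_dist[OF Fin fin] l1_norm_def suminf_nonneg)
    then show "\<exists>no. \<forall>i\<ge>no. norm (nrm_dist l1 (F i) f - 0) < e" by blast
  qed
  then have "limitin l1.metric.mtopology F f sequentially"
    using fin Fin by (simp add: l1.metric.limitin_metric_dist_null)
  then show "\<exists>f. limitin l1.metric.mtopology F f sequentially" by blast
qed

section \<open>Estimates for the coefficients and the explicit constant\<close>

lemma sum_wcoef: "(\<Sum>n\<le>p. wcoef a n) = wcoef (a + 1) p"
  using wcoef_convolution[of a 1 p] by (simp add: wcoef_1)

lemma wcoef_Suc_shift: "wcoef a (Suc p) * real (Suc p) = wcoef (a + 1) p * a"
  by (simp add: wcoef_def pochhammer_rec del: of_nat_Suc)

lemma wcoef_decseq: "0 \<le> a \<Longrightarrow> a \<le> 1 \<Longrightarrow> decseq (wcoef a)"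
proof (rule decseq_SucI)
  fix n assume "0 \<le> a" "a \<le> 1"
  then show "wcoef a (Suc n) \<le> wcoef a n"
    unfolding wcoef_Suc by (intro mult_left_le) (auto simp: wcoef_nonneg)
qed

lemma wcoef_incseq: "1 \<le> a \<Longrightarrow> incseq (wcoef a)"
proof (rule incseq_SucI)
  fix n assume "1 \<le> a"
  then show "wcoef a n \<le> wcoef a (Suc n)"
    unfolding wcoef_Suc using mult_left_mono[of 1 "(a + n) / (n + 1)" "wcoef a n"] by (simp add: wcoef_nonneg)
qed

text \<open>Write w and K for the coefficients of exponents \<alpha> and \<alpha> + 1. In the first
  sum K is increasing, so K(j + p) \<le> (1 + \<alpha>) K(p) comes out and leaves K(j). In the
  second sum w is decreasing, so w(p + 1) comes out and leaves a partial sum of K; this contributes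
  \<alpha> / (1 + \<alpha>).\<close>

lemma wcoef_omega_bound:
  assumes "0 < \<alpha>" "\<alpha> < 1" "1 \<le> j" "j \<le> p"
  shows "(\<Sum>n=0..j. wcoef \<alpha> n * wcoef (\<alpha> + 1) (j + p - n)) + (\<Sum>n=p+1..j+p. wcoef \<alpha> n * wcoef (\<alpha> + 1) (j + p - n))
    \<le> (1 + \<alpha> + \<alpha> / (1 + \<alpha>)) * wcoef (\<alpha> + 1) j * wcoef (\<alpha> + 1) p"
proof -
  define K where "K = wcoef (\<alpha> + 1)"
  define w where "w = wcoef \<alpha>"
  have w: "0 \<le> w n" and K: "0 < K n" for n using assms by (simp_all add: w_def K_def wcoef_nonneg wcoef_pos)
  have wdec: "w n \<le> w m" if "m \<le> n" for m n
    using decseqD[OF wcoef_decseq that] assms by (simp add: w_def)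
  have wp: "w (Suc p) = K p * \<alpha> / real (Suc p)"
    using wcoef_Suc_shift[of \<alpha> p] by (simp add: w_def K_def field_simps)
  \<comment> \<open>K is the sequence of partial sums of w; the increment is estimated by j times
    the largest term, w(p + 1), which is of order K(p) / (p + 1).\<close>
  have "K (j + p) = K p + (\<Sum>n=p+1..j+p. w n)"
  proof -
    have "{..j + p} = {..p} \<union> {p+1..j+p}" "{..p} \<inter> {p+1..j+p} = {}" by auto
    then show ?thesis unfolding K_def w_def sum_wcoef[symmetric] by (simp add: sum.union_disjoint)
  qed
  also have "(\<Sum>n=p+1..j+p. w n) \<le> (\<Sum>n=p+1..j+p. w (Suc p))" by (intro sum_mono wdec) auto
  also have "\<dots> = j * w (Suc p)" by simp
  also have "\<dots> \<le> K p * \<alpha>"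
  proof -
    have "real j / real (Suc p) \<le> 1" using assms by simp
    from mult_left_mono[OF this, of "K p * \<alpha>"] K[of p] assms show ?thesis by (simp add: wp mult_ac)
  qed
  finally have Kjp: "K (j + p) \<le> K p * (1 + \<alpha>)" by (simp add: algebra_simps)
  have "(\<Sum>n=0..j. w n * K (j + p - n)) \<le> (\<Sum>n=0..j. w n * K (j + p))"
    using assms unfolding K_def by (intro sum_mono mult_left_mono w incseqD[OF wcoef_incseq]) auto
  also have "\<dots> = K j * K (j + p)"
    unfolding sum_distrib_right[symmetric] by (simp add: atLeast0AtMost w_def sum_wcoef K_def)
  also have "\<dots> \<le> K j * (K p * (1 + \<alpha>))" using Kjp K[of j] by (simp add: mult_left_mono)
  finally have 1: "(\<Sum>n=0..j. w n * K (j + p - n)) \<le> (1 + \<alpha>) * K j * K p" by (simp add: mult_ac)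
  have "(\<Sum>n=p+1..j+p. w n * K (j + p - n)) \<le> (\<Sum>n=p+1..j+p. w (Suc p) * K (j + p - n))"
    using K by (intro sum_mono mult_right_mono wdec) (auto simp: less_imp_le)
  \<comment> \<open>The index i = j + p - n runs from j - 1 down to 0 as n runs from p + 1 to j +
    p.\<close>
  also have "\<dots> = w (Suc p) * (\<Sum>i\<le>j-1. K i)"
    unfolding sum_distrib_left[symmetric]
    by (rule arg_cong[where f = "(*) (w (Suc p))"], 
        rule sum.reindex_bij_witness[of _ "\<lambda>i. j + p - i" "\<lambda>n. j + p - n"]) (use assms in auto)
  \<comment> \<open>The partial sum is \<open>wcoef (\<alpha> + 2) (j - 1)\<close>, and raising the
    index by one lowers the exponent at the cost of the factor j / (1 + \<alpha>).\<close>
  also have "(\<Sum>i\<le>j-1. K i) = K j * j / (1 + \<alpha>)"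
    using wcoef_Suc_shift[of "\<alpha> + 1" "j - 1"] assms sum_wcoef[of "\<alpha> + 1" "j - 1"] by (simp add: K_def field_simps)
  also have "w (Suc p) * (K j * j / (1 + \<alpha>)) = (K p * K j * \<alpha> / (1 + \<alpha>)) * (j / real (Suc p))"
    by (simp add: wp mult_ac)
  also have "\<dots> \<le> (K p * K j * \<alpha> / (1 + \<alpha>)) * 1"
    using K assms by (intro mult_left_mono) (auto simp: less_imp_le)
  finally have 2: "(\<Sum>n=p+1..j+p. w n * K (j + p - n)) \<le> \<alpha> / (1 + \<alpha>) * K j * K p" by (simp add: mult_ac)
  show ?thesis using add_mono[OF 1 2] by (simp add: K_def w_def distrib_right)
qed

text \<open>Both sides vanish at 1, and the derivative of the difference is (t - 1)^2 / (t (t +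
  1)^2).\<close>

lemma ln_ge_rational:
  fixes x :: real assumes "x \<ge> 1" shows "2 * (x - 1) / (x + 1) \<le> ln x"
proof -
  have "ln 1 - 2 * (1 - 1) / (1 + 1) \<le> ln x - 2 * (x - 1) / (x + 1)"
  proof (rule DERIV_nonneg_imp_nondecreasing[OF assms])
    fix t :: real assume "1 \<le> t" "t \<le> x"
    then have "((\<lambda>x. ln x - 2 * (x - 1) / (x + 1)) has_real_derivative (1 / t - 4 / (t + 1)^2)) (at t)"
      by (auto intro!: derivative_eq_intros simp: power2_eq_square field_simps)
    moreover have "4 * t \<le> (t + 1)^2" using zero_le_power2[of "t - 1"] by (simp add: power2_eq_square algebra_simps)
    then have "0 \<le> 1 / t - 4 / (t + 1)^2" using \<open>1 \<le> t\<close> by (simp add: divide_simps)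
    ultimately show "\<exists>y. ((\<lambda>x. ln x - 2 * (x - 1) / (x + 1)) has_real_derivative y) (at t) \<and> 0 \<le> y" by blast
  qed
  then show ?thesis by simp
qed

text \<open>The right-hand side is 2 exp(\<alpha> L) - 1 with L = ln x. The quadratic Taylor bound
  for exp, after division by \<alpha>, reduces the claim to 1 + 1 / (1 + \<alpha>) \<le> 2 L +
  \<alpha> L^2, and the rational lower bound for L makes this a polynomial inequality.\<close>

lemma omega_constant_bound:
  fixes \<alpha> :: real assumes "0 < \<alpha>" "\<alpha> < 1"
  shows "1 + \<alpha> + \<alpha> / (1 + \<alpha>) \<le> 2 powr (\<alpha> + 1) * (1 + (1 - \<alpha>) / (2 * (1 + \<alpha>))) powr \<alpha> - 1"
proof -
  \<comment> \<open>Twice the base of the second power: the factor 2^\<alpha> of the first power is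
    absorbed into it.\<close>
  define x where "x = (3 + \<alpha>) / (1 + \<alpha>)"
  define L where "L = ln x"
  have x: "x \<ge> 1" using assms by (simp add: x_def)
  have "2 powr (\<alpha> + 1) * y powr \<alpha> = 2 * (2 * y) powr \<alpha>" if "y \<ge> 0" for y :: real
    using that by (simp add: powr_add powr_mult)
  then have "2 powr (\<alpha> + 1) * (1 + (1 - \<alpha>) / (2 * (1 + \<alpha>))) powr \<alpha> = 2 * (2 * (1 + (1 - \<alpha>) / (2 * (1 + \<alpha>)))) powr \<alpha>"
    using assms by simp
  also have "2 * (1 + (1 - \<alpha>) / (2 * (1 + \<alpha>))) = x" using assms by (simp add: x_def field_simps)
  finally have eq: "2 powr (\<alpha> + 1) * (1 + (1 - \<alpha>) / (2 * (1 + \<alpha>))) powr \<alpha> = 2 * exp (\<alpha> * L)"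
    using x by (simp add: powr_def L_def)
  have "x * (1 + \<alpha>) = 3 + \<alpha>" using assms by (simp add: x_def)
  then have "(2 * x - 2) * (2 + \<alpha>) = 2 * x + 2" by (simp add: algebra_simps)
  \<comment> \<open>For this x the rational lower bound of the logarithm simplifies to 2 / (2 +
    \<alpha>).\<close>
  then have "2 * (x - 1) / (x + 1) = 2 / (2 + \<alpha>)" using assms x by (simp add: frac_eq_eq)
  then have L: "2 / (2 + \<alpha>) \<le> L" using ln_ge_rational[OF x] by (simp add: L_def)
  have L0: "0 \<le> 2 / (2 + \<alpha>)" using assms by simp
  have "1 + 1 / (1 + \<alpha>) \<le> 2 * (2 / (2 + \<alpha>)) + \<alpha> * (2 / (2 + \<alpha>))^2"
  proof -
    \<comment> \<open>Controls the only negative term in 4 \<alpha> + 2 \<alpha>^2 - \<alpha>^3, the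
      difference of the two sides after clearing denominators.\<close>
    have "\<alpha>^3 \<le> \<alpha>" using assms power_decreasing[of 1 3 \<alpha>] by simp
    moreover have "8 * (1 + \<alpha>)^2 - (2 + \<alpha>)^3 = 4 * \<alpha> + 2 * \<alpha>^2 - \<alpha>^3"
      by (simp add: power2_eq_square power3_eq_cube algebra_simps)
    ultimately have "(2 + \<alpha>)^3 \<le> 8 * (1 + \<alpha>)^2"
      using assms zero_le_power2[of \<alpha>] by linarith
    then have "(2 + \<alpha>) / (1 + \<alpha>) \<le> 8 * (1 + \<alpha>) / (2 + \<alpha>)^2"
      using assms by (simp add: divide_simps power2_eq_square power3_eq_cube mult_ac)
    moreover have "1 + 1 / (1 + \<alpha>) = (2 + \<alpha>) / (1 + \<alpha>)" using assms by (simp add: field_simps)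
    moreover have "2 * (2 / (2 + \<alpha>)) + \<alpha> * (2 / (2 + \<alpha>))^2 = 8 * (1 + \<alpha>) / (2 + \<alpha>)^2"
      using assms by (simp add: divide_simps power2_eq_square)
    ultimately show ?thesis by simp
  qed
  also have "\<dots> \<le> 2 * L + \<alpha> * L^2"
    using assms L L0 by (intro add_mono mult_left_mono power_mono) auto
  finally have "\<alpha> * (1 + 1 / (1 + \<alpha>)) \<le> \<alpha> * (2 * L + \<alpha> * L^2)" using assms by simp
  also have "\<dots> = 2 * (1 + \<alpha> * L + (\<alpha> * L)^2 / 2) - 2" by (simp add: power2_eq_square algebra_simps)
  also have "\<dots> \<le> 2 * exp (\<alpha> * L) - 2"
    using exp_lower_Taylor_quadratic[of "\<alpha> * L"] assms L L0 by simp
  finally show ?thesis unfolding eq by (simp add: algebra_simps)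
qed

section \<open>The limit of the norms as the order tends to 0\<close>

lemma isCont_wcoef: "isCont (\<lambda>a. wcoef a n) x"
  by (induction n) (simp_all add: wcoef_Suc)

text \<open>For fixed f the norm is a finite sum whose terms depend continuously on the order, and
  its value at order 0 is the l1 norm.\<close>

lemma weyl_norm_tendsto_l1:
  assumes "f \<in> c00"
  shows "((\<lambda>\<epsilon>. weyl_norm \<epsilon> (cesaro (\<epsilon> + 1)) f) \<longlongrightarrow> l1_norm f) (at_right 0)"
proof -
  obtain N where N: "\<And>n. n \<ge> N \<Longrightarrow> f n = 0" using c00_iff assms by blast
  define q where "q \<epsilon> = (\<Sum>n<N. wcoef (\<epsilon> + 1) n *
    cmod (\<Sum>j<N. (if n \<le> j then of_real (wcoef (- \<epsilon>) (j - n)) else 0) * f j))" for \<epsilon>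
  have q: "weyl_norm \<epsilon> (wcoef (\<epsilon> + 1)) f = q \<epsilon>" if "\<epsilon> \<ge> 0" for \<epsilon>
    by (subst weyl_norm_eq_sum[OF that N], assumption) (simp add: q_def weyl_op_eq_sum[OF N])
  have if_cont: "isCont (\<lambda>\<epsilon>. if n \<le> j then complex_of_real (wcoef (- \<epsilon>) (j - n)) else 0) 0" for n j :: nat
    by (cases "n \<le> j") (auto intro!: continuous_intros isCont_o2[OF _ isCont_wcoef])
  have "isCont q 0" unfolding q_def[abs_def]
    by (intro continuous_intros if_cont isCont_o2[OF _ isCont_wcoef])
  then have "(q \<longlongrightarrow> q 0) (at_right 0)" by (simp add: isCont_def filterlim_at_split)
  moreover have "q 0 = l1_norm f" using q[of 0] by (simp add: l1_norm_eq_weyl_norm assms)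
  \<comment> \<open>The expression \<open>q\<close> is continuous at 0 from both sides, but it is
    identified with the norm only for nonnegative orders, hence the one-sided comparison.\<close>
  moreover have "eventually (\<lambda>\<epsilon>. q \<epsilon> = weyl_norm \<epsilon> (cesaro (\<epsilon> + 1)) f) (at_right 0)"
    unfolding eventually_at_right_field
  proof (intro exI[of _ 1] conjI allI impI)
    fix \<epsilon> :: real assume "0 < \<epsilon>" "\<epsilon> < 1"
    then have "cesaro (\<epsilon> + 1) = wcoef (\<epsilon> + 1)" by (intro ext cesaro_eq_wcoef) simp
    then show "q \<epsilon> = weyl_norm \<epsilon> (cesaro (\<epsilon> + 1)) f" using q[of \<epsilon>] \<open>0 < \<epsilon>\<close> by simp
  qed simp
  ultimately show ?thesis using Lim_transform_eventually by metis
qed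

section \<open>The difference operator and the inclusions of the completions\<close>

lemma weyl_norm_Delta:
  assumes "\<alpha> \<ge> 0" "\<And>n. 0 \<le> \<phi> n" "mono \<phi>" "f \<in> c00"
  shows "weyl_norm \<alpha> \<phi> (Delta f) \<le> 2 * weyl_norm \<alpha> \<phi> f"
proof -
  obtain N where N: "\<And>n. n \<ge> N \<Longrightarrow> f n = 0" using c00_iff assms by blast
  then have ND: "\<And>n. n \<ge> N \<Longrightarrow> Delta f n = 0" by (simp add: Delta_def)
  define F where "F = weyl_op (wcoef (- \<alpha>)) f"
  have FN: "F n = 0" if "n \<ge> N" for n unfolding F_def by (rule weyl_op_vanishes[OF N that])
  \<comment> \<open>Both are Weyl operators, so they commute: the coordinates of
    \<open>Delta f\<close> are the differences of the coordinates F of f.\<close>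
  have "weyl_op (wcoef (- \<alpha>)) (Delta f) = (\<lambda>n. - weyl_op (wcoef (- \<alpha> - 1)) f n)"
    using weyl_op_smult[of "wcoef (- \<alpha>)" "-1" "weyl_op (wcoef (- 1)) f"] assms(4)
    by (simp add: Delta_eq_weyl_op weyl_op_wcoef_comp minus_diff_commute)
  also have "\<dots> = Delta F"
    using assms(4) by (simp add: F_def Delta_eq_weyl_op weyl_op_c00 weyl_op_wcoef_comp minus_diff_commute)
  finally have "weyl_op (wcoef (- \<alpha>)) (Delta f) n = F (Suc n) - F n" for n
    by (simp add: Delta_def)
  note Delta_F = this
  have "weyl_norm \<alpha> \<phi> (Delta f) = (\<Sum>n<N. \<phi> n * cmod (F (Suc n) - F n))"
    by (subst weyl_norm_eq_sum[OF assms(1) ND], assumption) (simp add: Delta_F)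
  also have "\<dots> \<le> (\<Sum>n<N. \<phi> (Suc n) * cmod (F (Suc n)) + \<phi> n * cmod (F n))"
  proof (rule sum_mono)
    fix n
    have "\<phi> n * cmod (F (Suc n) - F n) \<le> \<phi> n * (cmod (F (Suc n)) + cmod (F n))"
      by (intro mult_left_mono norm_triangle_ineq4 assms)
    also have "\<dots> \<le> \<phi> (Suc n) * cmod (F (Suc n)) + \<phi> n * cmod (F n)"
      using mult_right_mono[OF monoD[OF assms(3), of n "Suc n"]] by (simp add: distrib_left)
    finally show "\<phi> n * cmod (F (Suc n) - F n) \<le> \<phi> (Suc n) * cmod (F (Suc n)) + \<phi> n * cmod (F n)" .
  qed
  also have "\<dots> = (\<Sum>n<N. \<phi> (Suc n) * cmod (F (Suc n))) + (\<Sum>n<N. \<phi> n * cmod (F n))"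
    by (rule sum.distrib)
  \<comment> \<open>The shifted sum lacks the term n = 0, which is nonnegative; the extra index N
    gained by the shift contributes nothing, since F(N) = 0.\<close>
  also have "(\<Sum>n<N. \<phi> (Suc n) * cmod (F (Suc n))) \<le> (\<Sum>n<Suc N. \<phi> n * cmod (F n))"
    unfolding sum.lessThan_Suc_shift using assms(2) by simp
  also have "(\<Sum>n<Suc N. \<phi> n * cmod (F n)) = (\<Sum>n<N. \<phi> n * cmod (F n))" by (simp add: FN)
  finally show ?thesis by (simp add: weyl_norm_eq_sum[OF assms(1) N] F_def)
qed

text \<open>The weighted norm is closable with respect to l1. The coordinates of F j tend to 0, so
  letting j tend to infinity in the estimate for F i - F j leaves the same estimate for F i.\<close>

lemma weyl_norm_tendsto_0_of_l1:
  assumes "\<alpha> \<ge> 0" "\<And>n. 0 < \<phi> n" and F: "F \<in> cauchy_seqs (seq_algebra c00 (weyl_norm \<alpha> \<phi>))"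
    and null: "(\<lambda>i. l1_norm (F i)) \<longlonglongrightarrow> 0"
  shows "(\<lambda>i. weyl_norm \<alpha> \<phi> (F i)) \<longlonglongrightarrow> 0"
proof (rule LIMSEQ_I)
  interpret A: normed_module "seq_algebra c00 (weyl_norm \<alpha> \<phi>)"
    by unfold_locales (rule weyl_normed_space[OF assms(1,2)])
  let ?w = "weyl_op (wcoef (- \<alpha>))"
  have c00: "F i \<in> c00" for i using A.cauchy_seqs_closed[OF F] by simp
  have nonneg: "\<phi> n \<ge> 0" for n using assms(2)[of n] by simp
  obtain B where B: "B > 0" "\<And>f n. f \<in> c00 \<Longrightarrow> cmod (?w f n) \<le> B * l1_norm f"
    using weyl_op_bound_l1[OF assms(1)] by blast
  have w_lim: "(\<lambda>j. ?w (F j) n) \<longlonglongrightarrow> 0" for n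
    by (rule tendsto_0_le[OF null, where K = B])
      (use B(2)[OF c00] in \<open>auto simp: mult.commute l1_norm_def suminf_nonneg c00_summable c00\<close>)
  have w_diff: "weyl_diff \<alpha> (\<lambda>n. F i n - F j n) n = ?w (F i) n - ?w (F j) n" for i j n
    using weyl_op_add[OF c00 smult_c00[OF c00], of "wcoef (- \<alpha>)" i "-1" j] weyl_op_smult[of "wcoef (- \<alpha>)" "-1" "F j"]
    by (simp add: weyl_diff_eq_weyl_op[OF assms(1) diff_c00[OF c00 c00]])
  have summ: "summable (\<lambda>n. \<phi> n * cmod (weyl_diff \<alpha> f n))" if "f \<in> c00" for f
  proof (rule summable_finite)
    show "finite {n. weyl_diff \<alpha> f n \<noteq> 0}"
      using weyl_op_c00[OF that, of "wcoef (- \<alpha>)"] by (simp add: weyl_diff_eq_weyl_op[OF assms(1) that] c00_def)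
  qed simp
  fix e :: real assume "e > 0"
  then have "eventually (\<lambda>p. nrm_dist (seq_algebra c00 (weyl_norm \<alpha> \<phi>)) (F (fst p)) (F (snd p)) < e / 2)
      (sequentially \<times>\<^sub>F sequentially)"
    using order_tendstoD(2)[OF A.cauchy_seqsD[OF F], of "e / 2"] by simp
  then obtain N where N: "\<And>m n. m \<ge> N \<Longrightarrow> n \<ge> N \<Longrightarrow> weyl_norm \<alpha> \<phi> (\<lambda>k. F m k - F n k) < e / 2"
    unfolding eventually_prod_sequentially by (auto simp: A.dist_eq c00 seq_algebra_minus c00_module)
  have "weyl_norm \<alpha> \<phi> (F i) \<le> e / 2" if i: "i \<ge> N" for i
  proof -
    let ?u = "\<lambda>j n. \<phi> n * cmod (?w (F i) n - ?w (F j) n)"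
    have "(\<lambda>j. ?u j n) \<longlonglongrightarrow> \<phi> n * cmod (?w (F i) n - 0)" for n by (intro tendsto_intros w_lim)
    moreover have "summable (?u j)" for j
      using summ[OF diff_c00[OF c00 c00], of i j] by (simp add: w_diff)
    moreover have "suminf (?u j) \<le> e / 2" if "j \<ge> N" for j
      using N[OF i that] by (simp add: weyl_norm_def w_diff)
    then have "eventually (\<lambda>j. suminf (?u j) \<le> e / 2) sequentially"
      unfolding eventually_sequentially by blast
    \<comment> \<open>Fatou's lemma in j with i fixed, where \<open>?u j\<close> has total mass
      equal to the norm of F i - F j.\<close>
    ultimately have "(\<Sum>n. \<phi> n * cmod (?w (F i) n - 0)) \<le> e / 2"
      using nonneg by (intro suminf_le_of_pointwise_limit(2)[of ?u]) auto
    then show ?thesis by (simp add: weyl_norm_def weyl_diff_eq_weyl_op[OF assms(1) c00])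
  qed
  then show "\<exists>no. \<forall>i\<ge>no. norm (weyl_norm \<alpha> \<phi> (F i) - 0) < e"
    using \<open>e > 0\<close> weyl_norm_nonneg[OF assms(1) nonneg c00] by (intro exI[of _ N]) fastforce
qed

text \<open>The identity on \<open>c00\<close> extends by \<open>le\<close>. For injectivity, a
  class that vanishes in the larger space is null in the norm of \<psi>, hence null in l1 by
  \<open>l1\<close>, hence null in the norm of \<phi> by closability.\<close>

lemma tau_inclusion:
  assumes "\<alpha> \<ge> 0" "\<And>n. 0 < \<phi> n" "\<beta> \<ge> 0" "\<And>n. 0 < \<psi> n"
    and le: "\<And>f. f \<in> c00 \<Longrightarrow> weyl_norm \<beta> \<psi> f \<le> C * weyl_norm \<alpha> \<phi> f"
    and l1: "\<And>f. f \<in> c00 \<Longrightarrow> l1_norm f \<le> weyl_norm \<beta> \<psi> f"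
  shows "continuous_inclusion (tau \<alpha> \<phi>) (tau_embed \<alpha> \<phi>) (tau \<beta> \<psi>) (tau_embed \<beta> \<psi>)"
proof -
  let ?A = "seq_algebra c00 (weyl_norm \<alpha> \<phi>)" and ?B = "seq_algebra c00 (weyl_norm \<beta> \<psi>)"
  interpret T: bounded_map ?A ?B "\<lambda>f. f"
    by unfold_locales (use le in \<open>auto simp: weyl_normed_space assms bounded_linear_map_def intro!: exI[of _ C]\<close>)
  have "inj_on T.completion_map (carrier (completion ?A))"
  proof (rule bounded_linear_map_inj_on[OF T.A.completion_normed_space T.B.completion_normed_space 
        T.completion_map_bounded])
    fix P assume "P \<in> carrier (completion ?A)" and 0: "nrm (completion ?B) (T.completion_map P) = 0"
    then obtain F where F: "F \<in> cauchy_seqs ?A" "P = T.A.cls F" using T.A.carrierE by blast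
    have c00: "F i \<in> c00" for i using T.A.cauchy_seqs_closed[OF F(1)] by simp
    have "(\<lambda>i. weyl_norm \<beta> \<psi> (F i)) \<longlonglongrightarrow> 0"
      using 0 F T.map_cauchy_seqs[OF F(1)] by (simp add: T.completion_map_cls T.B.completion_nrm_eq_0)
    then have "(\<lambda>i. l1_norm (F i)) \<longlonglongrightarrow> 0"
      by (rule tendsto_0_le[where K = 1]) 
        (use order_trans[OF l1 abs_ge_self] c00 in \<open>auto simp: l1_norm_def suminf_nonneg c00_summable\<close>)
    from weyl_norm_tendsto_0_of_l1[OF assms(1,2) F(1) this]
    show "nrm (completion ?A) P = 0" using F by (simp add: T.A.completion_nrm_eq_0)
  qed
  then show ?thesis unfolding continuous_inclusion_def tau_def tau_embed_def
    using T.completion_map_bounded T.completion_map_embed by auto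
qed

text \<open>Same argument as for two completions, with the extension taken into l1 itself, which is
  complete; the kernel is read off from representatives.\<close>

lemma tau_l1_inclusion:
  assumes "\<alpha> \<ge> 0" "\<And>n. 0 < \<phi> n" and l1: "\<And>f. f \<in> c00 \<Longrightarrow> l1_norm f \<le> weyl_norm \<alpha> \<phi> f"
  shows "continuous_inclusion (tau \<alpha> \<phi>) (tau_embed \<alpha> \<phi>) l1 (\<lambda>f. f)"
proof -
  let ?A = "seq_algebra c00 (weyl_norm \<alpha> \<phi>)"
  have "bounded_linear_map ?A l1 (\<lambda>f. f)"
    unfolding bounded_linear_map_def using l1
    by (auto simp: c00_summable intro!: exI[of _ 1]) (simp_all add: l1_def)
  then interpret T: bounded_map ?A l1 "\<lambda>f. f"
    by unfold_locales (simp_all add: weyl_normed_space assms)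
  obtain J where J: "bounded_linear_map (completion ?A) l1 J"
    "\<And>x. x \<in> carrier ?A \<Longrightarrow> J (completion_embed ?A x) = x"
    "\<And>P. P \<in> carrier (completion ?A) \<Longrightarrow> nrm l1 (J P) = nrm (completion l1) (T.completion_map P)"
    by (rule T.extension_to_complete[OF l1_mcomplete]) blast
  have "inj_on J (carrier (completion ?A))"
  proof (rule bounded_linear_map_inj_on[OF T.A.completion_normed_space l1_normed_space J(1)])
    fix P assume P: "P \<in> carrier (completion ?A)" and 0: "nrm l1 (J P) = 0"
    then obtain F where F: "F \<in> cauchy_seqs ?A" "P = T.A.cls F" using T.A.carrierE by blast
    have "(\<lambda>i. l1_norm (F i)) \<longlonglongrightarrow> 0"
      using 0 J(3)[OF P] l1.completion_nrm_eq_0[OF T.map_cauchy_seqs[OF F(1)]]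
      by (simp add: F(2) T.completion_map_cls[OF F(1)])
    from weyl_norm_tendsto_0_of_l1[OF assms(1,2) F(1) this]
    show "nrm (completion ?A) P = 0" using F by (simp add: T.A.completion_nrm_eq_0)
  qed
  then show ?thesis unfolding continuous_inclusion_def tau_def tau_embed_def using J(1,2) by auto
qed

lemma weyl_normed_algebra:
  assumes "\<alpha> \<ge> 0" "\<And>n. 0 < \<phi> n" "C > 0"
    and "\<And>f g. f \<in> c00 \<Longrightarrow> g \<in> c00 \<Longrightarrow> weyl_norm \<alpha> \<phi> (conv f g) \<le> C * weyl_norm \<alpha> \<phi> f * weyl_norm \<alpha> \<phi> g"
  shows "normed_algebra (seq_algebra c00 (weyl_norm \<alpha> \<phi>)) C"
  using c00_algebra weyl_normed_space[OF assms(1,2)] assms(3,4)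
  by (auto simp: normed_algebra_def normed_module_def normed_algebra_axioms_def)

lemma Delta_extends_to_tau:
  assumes "\<alpha> \<ge> 0" "\<And>n. 0 < \<phi> n" "mono \<phi>"
  shows "\<exists>T. bounded_linear_map (tau \<alpha> \<phi>) (tau \<alpha> \<phi>) T \<and> 
    (\<forall>f\<in>c00. T (tau_embed \<alpha> \<phi> f) = tau_embed \<alpha> \<phi> (Delta f))"
proof -
  let ?A = "seq_algebra c00 (weyl_norm \<alpha> \<phi>)"
  have "\<exists>C. \<forall>f\<in>c00. weyl_norm \<alpha> \<phi> (Delta f) \<le> C * weyl_norm \<alpha> \<phi> f"
    using weyl_norm_Delta[OF assms(1) less_imp_le[OF assms(2)] assms(3)] by blast
  then have "bounded_linear_map ?A ?A Delta"
    unfolding bounded_linear_map_def by (auto simp: Delta_c00 Delta_def fun_eq_iff algebra_simps)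
  then interpret T: bounded_map ?A ?A Delta
    by unfold_locales (simp_all add: weyl_normed_space assms)
  show ?thesis unfolding tau_def tau_embed_def
    using T.completion_map_bounded T.completion_map_embed by auto
qed

lemma weyl_norm_conv_le_of_lt_1:
  assumes "0 < \<alpha>" "\<alpha> < 1" "f \<in> c00" "g \<in> c00"
  shows "weyl_norm \<alpha> (wcoef (\<alpha> + 1)) (conv f g)
    \<le> (2 powr (\<alpha> + 1) * (1 + (1 - \<alpha>) / (2 * (1 + \<alpha>))) powr \<alpha> - 1)
      * weyl_norm \<alpha> (wcoef (\<alpha> + 1)) f * weyl_norm \<alpha> (wcoef (\<alpha> + 1)) g"
proof (rule weyl_norm_conv_le[OF _ _ _ _ assms(3,4)])
  let ?C = "2 powr (\<alpha> + 1) * (1 + (1 - \<alpha>) / (2 * (1 + \<alpha>))) powr \<alpha> - 1"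
  have C: "1 + \<alpha> + \<alpha> / (1 + \<alpha>) \<le> ?C" by (rule omega_constant_bound[OF assms(1,2)])
  moreover have "0 \<le> \<alpha> / (1 + \<alpha>)" using assms by simp
  \<comment> \<open>The weight has value 1 at 0, so the condition for the atom of index 0 only says
    that the constant is at least 1.\<close>
  ultimately show "1 \<le> ?C * wcoef (\<alpha> + 1) 0"
    unfolding wcoef_0 mult_1_right using assms(1) by linarith
  show "(\<Sum>n=0..j. wcoef \<alpha> n * wcoef (\<alpha> + 1) (j + p - n)) + (\<Sum>n=p+1..j+p. wcoef \<alpha> n * wcoef (\<alpha> + 1) (j + p - n))
    \<le> ?C * wcoef (\<alpha> + 1) j * wcoef (\<alpha> + 1) p" if "1 \<le> j" "j \<le> p" for j p
    by (rule order_trans[OF wcoef_omega_bound[OF assms(1,2) that]])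
      (use assms in \<open>intro mult_right_mono C; simp add: wcoef_nonneg\<close>)
qed (use assms in \<open>auto simp: wcoef_nonneg\<close>)

theorem theorem10:
  fixes \<alpha> :: real and \<phi> :: "nat \<Rightarrow> real"
  assumes "\<alpha> > 0" and "\<phi> \<in> omega_loc \<alpha>"
  shows
    "normed_space (seq_algebra c00 (weyl_norm \<alpha> \<phi>)) \<and>
     (\<exists>C>0. \<forall>f\<in>c00. \<forall>g\<in>c00.
        weyl_norm \<alpha> \<phi> (conv f g) \<le> C * weyl_norm \<alpha> \<phi> f * weyl_norm \<alpha> \<phi> g) \<and>
     banach_algebra (tau \<alpha> \<phi>) \<and>
     (\<phi> \<in> omega \<alpha> \<longrightarrow>
        (\<exists>T. bounded_linear_map (tau \<alpha> \<phi>) (tau \<alpha> \<phi>) T \<and>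
             (\<forall>f\<in>c00. T (tau_embed \<alpha> \<phi> f) = tau_embed \<alpha> \<phi> (Delta f))) \<and>
        (continuous_inclusion
           (tau \<alpha> \<phi>) (tau_embed \<alpha> \<phi>)
           (tau \<alpha> (cesaro (\<alpha> + 1))) (tau_embed \<alpha> (cesaro (\<alpha> + 1))) \<and>
         continuous_inclusion
           (tau \<alpha> (cesaro (\<alpha> + 1))) (tau_embed \<alpha> (cesaro (\<alpha> + 1)))
           l1 (\<lambda>f. f) \<and>
         (\<forall>f\<in>c00. ((\<lambda>\<epsilon>. weyl_norm \<epsilon> (cesaro (\<epsilon> + 1)) f) \<longlongrightarrow> l1_norm f) (at_right 0))) \<and>
        (\<forall>\<beta>>\<alpha>. continuous_inclusion
           (tau \<beta> (cesaro (\<beta> + 1))) (tau_embed \<beta> (cesaro (\<beta> + 1)))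
           (tau \<alpha> (cesaro (\<alpha> + 1))) (tau_embed \<alpha> (cesaro (\<alpha> + 1)))) \<and>
        (\<alpha> < 1 \<longrightarrow>
           (\<forall>f\<in>carrier (tau \<alpha> (cesaro (\<alpha> + 1))). \<forall>g\<in>carrier (tau \<alpha> (cesaro (\<alpha> + 1))).
              nrm (tau \<alpha> (cesaro (\<alpha> + 1))) (f \<otimes>\<^bsub>tau \<alpha> (cesaro (\<alpha> + 1))\<^esub> g)
                \<le> (2 powr (\<alpha> + 1) * (1 + (1 - \<alpha>) / (2 * (1 + \<alpha>))) powr \<alpha> - 1)
                   * nrm (tau \<alpha> (cesaro (\<alpha> + 1))) f * nrm (tau \<alpha> (cesaro (\<alpha> + 1))) g)))"
proof -
  have \<alpha>: "\<alpha> \<ge> 0" using assms(1) by simp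
  have pos: "0 < \<phi> n" for n using omega_loc_pos[OF assms(2)] .
  have cesaro: "cesaro (\<beta> + 1) = wcoef (\<beta> + 1)" if "\<beta> \<ge> \<alpha>" for \<beta>
    using that assms(1) by (intro ext cesaro_eq_wcoef) simp
  have wpos: "0 < wcoef (\<beta> + 1) n" if "\<beta> \<ge> \<alpha>" for \<beta> n using that assms(1) by (simp add: wcoef_pos)
  obtain C where C: "C > 0" "\<And>f g. f \<in> c00 \<Longrightarrow> g \<in> c00 \<Longrightarrow>
      weyl_norm \<alpha> \<phi> (conv f g) \<le> C * weyl_norm \<alpha> \<phi> f * weyl_norm \<alpha> \<phi> g"
    using omega_loc_conv_bounded[OF assms] by blast
  have banach: "banach_algebra (tau \<alpha> \<phi>)"
    unfolding tau_def by (rule normed_algebra.completion_banach_algebra[OF weyl_normed_algebra[OF \<alpha> pos C]])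
  have incl: "continuous_inclusion (tau \<alpha> \<phi>) (tau_embed \<alpha> \<phi>)
      (tau \<alpha> (cesaro (\<alpha> + 1))) (tau_embed \<alpha> (cesaro (\<alpha> + 1)))" if "\<phi> \<in> omega \<alpha>"
  proof -
    define c where "c = (INF n. inverse (cesaro (\<alpha> + 1) n) * \<phi> n)"
    have c: "c > 0" using that by (simp add: omega_def c_def)
    \<comment> \<open>The infimum is a lower bound because the ratios are bounded below by
      0.\<close>
    have le: "c \<le> inverse (wcoef (\<alpha> + 1) n) * \<phi> n" for n
      unfolding c_def cesaro[OF order_refl] using wpos[of \<alpha>] pos
      by (intro cINF_lower bdd_belowI[of _ 0]) (auto simp: less_imp_le)
    have "w \<le> 1 / c * y" if "c \<le> inverse w * y" "0 < w" for w y
      using that c by (simp add: field_simps)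
    then have "wcoef (\<alpha> + 1) n \<le> 1 / c * \<phi> n" for n
      using le wpos[of \<alpha>] by blast
    \<comment> \<open>Both norms have order \<alpha> and hence the same basis of atoms, so the
      comparison of weights with factor 1 / c is already the comparison of norms.\<close>
    then show ?thesis unfolding cesaro[OF order_refl] using assms(1) wpos[of \<alpha>] pos
      by (intro tau_inclusion[where C = "1 / c"] weyl_norm_le_atoms l1_norm_le_weyl_norm)
        (auto simp: weyl_norm_atom_self less_imp_le)
  qed
  have incl_beta: "continuous_inclusion (tau \<beta> (cesaro (\<beta> + 1))) (tau_embed \<beta> (cesaro (\<beta> + 1)))
      (tau \<alpha> (cesaro (\<alpha> + 1))) (tau_embed \<alpha> (cesaro (\<alpha> + 1)))" if "\<beta> > \<alpha>" for \<beta>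
    using that \<alpha> wpos weyl_norm_wcoef_mono[of \<alpha> \<beta>]
    by (simp add: cesaro) (intro tau_inclusion[where C = 1] l1_norm_le_weyl_norm; simp)
  have incl_l1: "continuous_inclusion (tau \<alpha> (cesaro (\<alpha> + 1))) (tau_embed \<alpha> (cesaro (\<alpha> + 1))) l1 (\<lambda>f. f)"
    unfolding cesaro[OF order_refl] by (intro tau_l1_inclusion \<alpha> wpos l1_norm_le_weyl_norm order_refl)
  have sharp: "nrm (tau \<alpha> (cesaro (\<alpha> + 1))) (f \<otimes>\<^bsub>tau \<alpha> (cesaro (\<alpha> + 1))\<^esub> g)
      \<le> (2 powr (\<alpha> + 1) * (1 + (1 - \<alpha>) / (2 * (1 + \<alpha>))) powr \<alpha> - 1)
        * nrm (tau \<alpha> (cesaro (\<alpha> + 1))) f * nrm (tau \<alpha> (cesaro (\<alpha> + 1))) g"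
    if "\<alpha> < 1" "f \<in> carrier (tau \<alpha> (cesaro (\<alpha> + 1)))" "g \<in> carrier (tau \<alpha> (cesaro (\<alpha> + 1)))" for f g
  proof -
    have "0 \<le> \<alpha> / (1 + \<alpha>)" using \<alpha> by simp
    \<comment> \<open>Positivity of the constant, demanded by \<open>normed_algebra\<close>, comes
      from its lower bound 1 + \<alpha> + \<alpha> / (1 + \<alpha>).\<close>
    then have "0 < 2 powr (\<alpha> + 1) * (1 + (1 - \<alpha>) / (2 * (1 + \<alpha>))) powr \<alpha> - 1"
      using omega_constant_bound[OF assms(1) that(1)] \<alpha> by linarith
    from normed_algebra.completion_submult[OF weyl_normed_algebra[OF \<alpha> wpos this
        weyl_norm_conv_le_of_lt_1[OF assms(1) that(1)]]] that
    show ?thesis unfolding tau_def cesaro[OF order_refl] by simp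
  qed
  show ?thesis
    using weyl_normed_space[OF \<alpha> pos] omega_loc_conv_bounded[OF assms] banach incl incl_beta incl_l1 sharp
      Delta_extends_to_tau[OF \<alpha> pos] weyl_norm_tendsto_l1 by (simp add: omega_def)
qed

end
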